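(* Let $T>0$, $0<\rho<2$, $A\in\mathbb C^{N\times N}$. Assume that the temporal roots satisfy $\lambda_{j,m}^{\sigma}\ne\lambda_{k,n}^{\eta}$ whenever $(j,m)\ne(k,n)$ (for all $1\le j,k\le p_0$, $m,n\ge1$, $\sigma,\eta\in\{+,-\}$), and let $\alpha\in\mathbb C$ be fixed such that $(\lambda_{j,m}^{\sigma})^2+\alpha\ne0$ for all $1\le j\le p_0$, $m\ge1$, $\sigma\in\Sigma_{j,m}$. Then there exist functions $g_{j,q,m}^{\sigma}\in L^2(0,T)$, indexed by $1\le j\le p_0$, $m\ge1$, $\sigma\in\Sigma_{j,m}$, $0\le q<d_{j,m}^{\sigma}$, and constants $M\ge0$, $C_T>0$ independent of $j,q,m,\sigma$, such that for all admissible indices $(j,q,m,\sigma)$ and $(p,r,n,\eta)$ $$\int_0^T E_{p,r,n}^{\eta}(t)\,g_{j,q,m}^{\sigma}(t)\,dt=\delta_{jp}\delta_{qr}\delta_{mn}\delta_{\sigma\eta},$$ $$\int_0^T\chi_\alpha^d(t)\,g_{j,q,m}^{\sigma}(t)\,dt=0,\qquad d=0,1,$$ $$\|g_{j,q,m}^{\sigma}\|_{L^2(0,T)}\le C_T(1+m)^M e^{C_Tm}.$$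
   Context: $\sigma(A)=\{\gamma_1,\dots,\gamma_{p_0}\}$ are the distinct eigenvalues of $A$, and $\nu_j$ is the size of the largest Jordan block of $A$ for $\gamma_j$. For $m\ge1$ the temporal roots are $$\lambda_{j,m}^{\pm}=\frac{-\rho m^2\pm\sqrt{\rho^2m^4-4(m^4+\gamma_j)}}2$$ (the two roots of $z^2+\rho m^2z+m^4+\gamma_j=0$). Set $\mathcal D_\rho=\{(j,m):\lambda_{j,m}^+=\lambda_{j,m}^-\}$ (a finite set), and for $(j,m)\in\mathcal D_\rho$ put $\lambda_{j,m}^{\mathrm c}:=\lambda_{j,m}^{+}=\lambda_{j,m}^-=-\rho m^2/2$. Set $\Sigma_{j,m}=\{+,-\}$ if $(j,m)\notin\mathcal D_\rho$ and $\Sigma_{j,m}=\{\mathrm c\}$ if $(j,m)\in\mathcal D_\rho$; $d_{j,m}^{\pm}=\nu_j$, $d_{j,m}^{\mathrm c}=2\nu_j$. With $\tau=T-t$, $E_{j,q,m}^{\sigma}(t)=\tau^qe^{\lambda_{j,m}^{\sigma}\tau}$ for $\sigma\in\Sigma_{j,m}$, $0\le q<d_{j,m}^\sigma$. Let $\omega\in\mathbb C$ with $\omega^2=-\alpha$, and $(\chi_\alpha^0,\chi_\alpha^1)=(e^{\omega\tau},e^{-\omega\tau})$ if $\omega\ne0$, $(\chi_\alpha^0,\chi_\alpha^1)=(1,\tau)$ if $\omega=0$. Functions are complex valued and the integrals are bilinear pairings (no complex conjugation). *)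

theory Defs
  imports
    "HOL-Analysis.Analysis"
    "Jordan_Normal_Form.Spectral_Radius"
    "Jordan_Normal_Form.Jordan_Normal_Form_Uniqueness"
begin

text \<open>
  A Jordan form is a list of pairs (block size, eigenvalue), unique up to permutation.
  For a square complex matrix \<open>A\<close> and an eigenvalue \<open>c\<close>, the set below is finite and nonempty.
\<close>

definition largest_jordan_block :: "complex mat \<Rightarrow> complex \<Rightarrow> nat" where
  "largest_jordan_block A c = Max {k. \<exists>n_as. jordan_nf A n_as \<and> (k, c) \<in> set n_as}"

lemma largest_jordan_block_eq:
  assumes "jordan_nf A n_as"
  shows "largest_jordan_block A c = Max {k. (k, c) \<in> set n_as}"
proof -
  have "set m_as = set n_as" if "jordan_nf A m_as" for m_as
    by (rule jordan_nf_unique[OF that assms])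
  then have "{k. \<exists>n_as. jordan_nf A n_as \<and> (k, c) \<in> set n_as} = {k. (k, c) \<in> set n_as}"
    using assms by blast
  then show ?thesis
    by (simp add: largest_jordan_block_def)
qed

lemma largest_jordan_block_mem:
  assumes "A \<in> carrier_mat n n" "jordan_nf A n_as" "eigenvalue A c"
  shows "(largest_jordan_block A c, c) \<in> set n_as" "largest_jordan_block A c > 0"
proof -
  have "poly (char_poly A) c = 0"
    using assms(1,3) eigenvalue_root_char_poly by blast
  then have "\<exists>k. (k, c) \<in> set n_as"
    unfolding jordan_nf_char_poly[OF assms(2)]
    by (auto simp: poly_prod_list prod_list_zero_iff)
  moreover have "{k. (k, c) \<in> set n_as} \<subseteq> fst ` set n_as"
    by force
  then have "finite {k. (k, c) \<in> set n_as}"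
    by (rule finite_subset) simp
  ultimately show mem: "(largest_jordan_block A c, c) \<in> set n_as"
    using Max_in[of "{k. (k, c) \<in> set n_as}"]
    by (auto simp: largest_jordan_block_eq[OF assms(2)])
  show "largest_jordan_block A c > 0"
    using imageI[OF mem, of fst] assms(2) unfolding jordan_nf_def by (cases "largest_jordan_block A c") auto
qed

datatype label = Plus | Minus | Crit

text \<open>
  The sign of the square root of the complex discriminant is fixed by taking the principal
  branch; another choice only exchanges the labels \<open>Plus\<close> and \<open>Minus\<close>.
  The value at \<open>Crit\<close> is used only where the two roots coincide.
\<close>

fun temporal_root :: "real \<Rightarrow> complex \<Rightarrow> nat \<Rightarrow> label \<Rightarrow> complex" where
  "temporal_root \<rho> c m Plus =
     (- of_real \<rho> * of_nat m ^ 2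
      + csqrt (of_real \<rho> ^ 2 * of_nat m ^ 4 - 4 * (of_nat m ^ 4 + c))) / 2"
| "temporal_root \<rho> c m Minus =
     (- of_real \<rho> * of_nat m ^ 2
      - csqrt (of_real \<rho> ^ 2 * of_nat m ^ 4 - 4 * (of_nat m ^ 4 + c))) / 2"
| "temporal_root \<rho> c m Crit = - of_real \<rho> * of_nat m ^ 2 / 2"

lemma temporal_root_iff:
  "z ^ 2 + of_real \<rho> * of_nat m ^ 2 * z + of_nat m ^ 4 + c = 0 \<longleftrightarrow>
     z = temporal_root \<rho> c m Plus \<or> z = temporal_root \<rho> c m Minus"
proof -
  define b where "b = (of_real \<rho> * of_nat m ^ 2 :: complex)"
  define e where "e = (of_nat m ^ 4 + c :: complex)"
  define s where "s = csqrt (b ^ 2 - 4 * e)"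
  have s2: "s ^ 2 = b ^ 2 - 4 * e"
    by (simp add: s_def)
  have roots: "temporal_root \<rho> c m Plus = (- b + s) / 2"
      "temporal_root \<rho> c m Minus = (- b - s) / 2"
    by (simp_all add: s_def b_def e_def power_mult_distrib flip: power_mult)
  have "4 * (z ^ 2 + b * z + e) = (2 * z + b) ^ 2 - s ^ 2"
    unfolding s2 by (simp add: power2_eq_square algebra_simps)
  also have "\<dots> = 4 * ((z - (- b + s) / 2) * (z - (- b - s) / 2))"
    by (simp add: power2_eq_square algebra_simps diff_divide_distrib add_divide_distrib)
  finally have "z ^ 2 + b * z + e = (z - (- b + s) / 2) * (z - (- b - s) / 2)"
    by (metis mult_left_cancel zero_neq_numeral)
  then show ?thesis
    unfolding roots by (simp add: b_def e_def add.assoc)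
qed

definition double_root :: "real \<Rightarrow> complex \<Rightarrow> nat \<Rightarrow> bool" where
  "double_root \<rho> c m \<longleftrightarrow> temporal_root \<rho> c m Plus = temporal_root \<rho> c m Minus"

lemma temporal_root_Crit:
  "double_root \<rho> c m \<Longrightarrow> temporal_root \<rho> c m Plus = temporal_root \<rho> c m Crit"
  "double_root \<rho> c m \<Longrightarrow> temporal_root \<rho> c m Minus = temporal_root \<rho> c m Crit"
  by (auto simp: double_root_def)

definition labels :: "real \<Rightarrow> complex \<Rightarrow> nat \<Rightarrow> label set" where
  "labels \<rho> c m = (if double_root \<rho> c m then {Crit} else {Plus, Minus})"

fun chain_length :: "complex mat \<Rightarrow> complex \<Rightarrow> label \<Rightarrow> nat" where
  "chain_length A c Crit = 2 * largest_jordan_block A c"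
| "chain_length A c _ = largest_jordan_block A c"

definition admissible ::
    "complex mat \<Rightarrow> real \<Rightarrow> nat \<Rightarrow> (nat \<Rightarrow> complex) \<Rightarrow> (nat \<times> nat \<times> nat \<times> label) set" where
  "admissible A \<rho> p0 \<gamma> =
     {(j, q, m, \<sigma>). j \<in> {1..p0} \<and> m \<ge> 1 \<and> \<sigma> \<in> labels \<rho> (\<gamma> j) m \<and> q < chain_length A (\<gamma> j) \<sigma>}"

definition exp_mode ::
    "real \<Rightarrow> real \<Rightarrow> complex \<Rightarrow> nat \<Rightarrow> nat \<Rightarrow> label \<Rightarrow> real \<Rightarrow> complex" where
  "exp_mode T \<rho> c q m \<sigma> t =
     of_real (T - t) ^ q * exp (temporal_root \<rho> c m \<sigma> * of_real (T - t))"

definition chi :: "real \<Rightarrow> complex \<Rightarrow> nat \<Rightarrow> real \<Rightarrow> complex" where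
  "chi T \<omega> d t =
     (if \<omega> \<noteq> 0 then (if d = 0 then exp (\<omega> * of_real (T - t)) else exp (- \<omega> * of_real (T - t)))
      else (if d = 0 then 1 else of_real (T - t)))"

definition in_L2 :: "real \<Rightarrow> (real \<Rightarrow> complex) \<Rightarrow> bool" where
  "in_L2 T f \<longleftrightarrow> f \<in> borel_measurable (lebesgue_on {0<..<T}) \<and>
     integrable (lebesgue_on {0<..<T}) (\<lambda>t. (norm (f t))\<^sup>2)"

definition L2_norm :: "real \<Rightarrow> (real \<Rightarrow> complex) \<Rightarrow> real" where
  "L2_norm T f = sqrt (LINT t|lebesgue_on {0<..<T}. (norm (f t))\<^sup>2)"

end

theory Submission
  imports Defs "HOL-Complex_Analysis.Complex_Analysis"
begin

text \<open>
  Put \<open>\<tau> = T - t\<close>. For a function \<open>f\<close> of \<open>\<tau>\<close> on \<open>[0, T]\<close> let \<open>F(z)\<close> be the integral of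
  \<open>exp (z \<tau>) f(\<tau>)\<close>. The derivative of order \<open>r\<close> of \<open>F\<close> at \<open>\<lambda>\<close> is the integral of \<open>f\<close> against
  \<open>\<tau>^r exp (\<lambda> \<tau>)\<close>, so biorthogonality is a Hermite interpolation problem for \<open>F\<close>: for each root
  \<open>w\<close> of level \<open>m\<close>, prescribed Taylor coefficients at \<open>w\<close> and zeros of sufficient order at the
  other roots and at \<open>\<omega>\<close>, \<open>-\<omega>\<close>.

  The solution has the form \<open>F(z) = S(z) \<Psi>(z)\<close>. Here \<open>S\<close> is an entire function with the required
  zeros, and \<open>\<Psi>\<close> is the transform of the bump function \<open>\<psi>(\<tau>) = exp (-b/\<tau> - b/(T - \<tau>))\<close>. If
  \<open>S(z)\<close> is the sum of \<open>p_n z^n\<close>, integration by parts shows that \<open>S \<Psi>\<close> is the transform of the sum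
  of \<open>(-1)^n p_n \<psi>^(n)\<close>. Since the roots of level \<open>m\<close> have size \<open>m^2\<close>, one can take \<open>S\<close> with
  growth \<open>exp (C sqrt |z|)\<close>, and then Cauchy's inequality on the circle of radius \<open>n^2\<close> gives
  \<open>|p_n| \<le> K exp (C n) / n^(2n)\<close>. On the other hand \<open>|\<psi>^(n)| \<le> (n!)^2 (9/b)^n\<close>. A large \<open>b\<close> makes
  the series converge geometrically, however small \<open>T\<close> is
  (\<open>exists_continuous_with_transform\<close>).

  To keep \<open>F\<close> away from \<open>0\<close> at \<open>w\<close>, this is done for \<open>S(z + \<i> Im w)\<close>, and the result is multiplied
  by \<open>exp (-\<i> Im w \<tau>)\<close>. As \<open>|Im w|\<close> is of order \<open>m^2\<close>, the shift costs a factor \<open>exp (C m)\<close> in the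
  growth of \<open>S\<close>; in return \<open>\<Psi>\<close> is evaluated at the real point \<open>Re w\<close>, where the integrand is positive
  and its part with \<open>\<tau>\<close> of order \<open>T/m\<close> is already at least \<open>exp (-C m)\<close>. Multiplying \<open>S\<close> by the powers
  \<open>(z - w)^q\<close> yields functions whose moments at \<open>w\<close> form a triangular matrix, and inverting that
  matrix costs another factor \<open>exp (C m)\<close> (\<open>exists_biorthogonal_chain\<close>).

  It remains to find \<open>S\<close>. The two roots of level \<open>n\<close> for \<open>\<gamma>_k\<close> are the zeros of
  \<open>p_{k,n}(z) = z^2 + \<rho> n^2 z + n^4 + \<gamma>_k\<close>, and \<open>S\<close> is, up to finitely many factors, the product of
  the powers \<open>(p_{k,n}(z) / n^4)^\<nu>\<close> over all \<open>(k, n) \<noteq> (j, m)\<close>. The growth bound is a comparison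
  with the product for the hyperbolic sine. The lower bound for \<open>|S(w)|\<close> rests on the identity
  \<open>p_{k,n}(w) = (n^2 - m^2) (\<rho> w + n^2 + m^2) + \<gamma>_k - \<gamma>_j\<close>: the second bracket is comparable with
  \<open>n^2 + m^2\<close> because \<open>w\<close> stays away from the real axis, and the product of the ratios
  \<open>|n - m| / n\<close> over \<open>n \<le> L m\<close>, \<open>n \<noteq> m\<close>, is the inverse of a binomial coefficient (\<open>symbol_lower_bound\<close>).
\<close>

section \<open>A bump function of Gevrey order two\<close>

text \<open>
  The bump function is needed off the real axis, because its derivatives are estimated by
  Cauchy's inequality.
\<close>

definition bump_ext :: "real \<Rightarrow> real \<Rightarrow> complex \<Rightarrow> complex" where
  "bump_ext b T \<zeta> = exp (- (of_real b / \<zeta>) - of_real b / (of_real T - \<zeta>))"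

text \<open>
  Extension by \<open>0\<close> makes this continuous at \<open>0\<close> and \<open>T\<close>, where the bump is flat, so that
  integration by parts on \<open>[0, T]\<close> has no boundary terms.
\<close>

definition bump_deriv :: "real \<Rightarrow> real \<Rightarrow> nat \<Rightarrow> real \<Rightarrow> complex" where
  "bump_deriv b T n x = (if 0 < x \<and> x < T then (deriv ^^ n) (bump_ext b T) (of_real x) else 0)"

lemma power_times_exp_minus_le_fact:
  fixes y :: real
  assumes "y \<ge> 0"
  shows "y ^ k * exp (- y) \<le> fact k"
proof -
  have "y ^ k / fact k = (\<Sum>i\<in>{k}. y ^ i / fact i)" by simp
  moreover have "(\<lambda>i. y ^ i / fact i) sums exp y"
    using exp_converges[of y] by (simp add: divide_inverse_commute)
  then have "(\<Sum>i\<in>{k}. y ^ i / fact i) \<le> exp y"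
    using assms sum_le_suminf[of "\<lambda>i. y ^ i / fact i" "{k}"] by (simp add: sums_iff)
  ultimately show ?thesis by (simp add: exp_minus field_simps)
qed

text \<open>
  Near the positive axis the modulus of \<open>exp (-b/\<zeta>)\<close> is as small as at a comparable real point.
\<close>

lemma Re_of_real_div_ge:
  fixes \<zeta> :: complex
  assumes "b > 0" "x > 0" "norm (\<zeta> - of_real x) \<le> x / 2"
  shows "Re (of_real b / \<zeta>) \<ge> 2 * b / (9 * x)"
proof -
  have re: "Re \<zeta> \<ge> x / 2"
    using abs_Re_le_cmod[of "\<zeta> - of_real x"] assms by simp
  have nrm: "norm \<zeta> \<le> 3 * x / 2"
    using norm_triangle_ineq2[of \<zeta> "of_real x"] assms by simp
  have pos: "norm \<zeta> > 0" using re assms by auto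
  have "(norm \<zeta>)\<^sup>2 \<le> (3 * x / 2)\<^sup>2" using nrm by (intro power_mono) auto
  then have "2 * (norm \<zeta>)\<^sup>2 \<le> 9 * x * (x / 2)" by (simp add: power2_eq_square field_simps)
  also have "\<dots> \<le> 9 * x * Re \<zeta>" using re assms by (intro mult_left_mono) auto
  finally have "2 * b * (norm \<zeta>)\<^sup>2 \<le> 9 * x * (b * Re \<zeta>)" using assms by simp
  then have "2 * b / (9 * x) \<le> b * Re \<zeta> / (norm \<zeta>)\<^sup>2" 
    using assms pos by (simp add: field_simps)
  also have "\<dots> = Re (of_real b / \<zeta>)" by (simp add: Re_divide' cmod_power2)
  finally show ?thesis .
qed

lemma bump_ext_norm_le:
  assumes "b > 0" "0 < x" "x < T" "norm (\<zeta> - of_real x) \<le> min x (T - x) / 2"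
  shows "norm (bump_ext b T \<zeta>) \<le> exp (- (2 * b / (9 * min x (T - x))))"
proof -
  have 1: "Re (of_real b / \<zeta>) \<ge> 2 * b / (9 * x)"
    using assms by (intro Re_of_real_div_ge) auto
  have "norm (of_real T - \<zeta> - of_real (T - x)) = norm (\<zeta> - of_real x)"
    by (subst norm_minus_cancel[symmetric]) (simp add: algebra_simps)
  then have 2: "Re (of_real b / (of_real T - \<zeta>)) \<ge> 2 * b / (9 * (T - x))"
    using assms by (intro Re_of_real_div_ge) auto
  have 3: "2 * b / (9 * x) > 0" "2 * b / (9 * (T - x)) > 0" using assms by auto
  have "2 * b / (9 * min x (T - x)) \<le> Re (of_real b / \<zeta>) + Re (of_real b / (of_real T - \<zeta>))"
  proof (cases "x \<le> T - x")
    case True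
    then have "min x (T - x) = x" by simp
    then show ?thesis using 1 2 3 by simp
  next
    case False
    then have "min x (T - x) = T - x" by simp
    then show ?thesis using 1 2 3 by simp
  qed
  then show ?thesis unfolding bump_ext_def norm_exp_eq_Re by simp
qed

lemma bump_ext_holomorphic: "bump_ext b T holomorphic_on - {0, of_real T}"
  unfolding bump_ext_def by (intro holomorphic_intros) auto

lemma bump_higher_deriv_le:
  assumes "b > 0" "0 < x" "x < T"
  defines "d \<equiv> min x (T - x)"
  shows "norm ((deriv ^^ n) (bump_ext b T) (of_real x)) \<le> fact n * (2 / d) ^ n * exp (- (2 * b / (9 * d)))"
proof -
  have d: "d > 0" using assms by (auto simp: d_def)
  have sub: "cball (of_real x) (d / 2) \<subseteq> - {0, complex_of_real T}"
  proof -
    have "dist (complex_of_real x) 0 = x" "dist (complex_of_real x) (of_real T) = T - x"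
      using assms by (simp_all add: dist_norm flip: of_real_diff del: of_real_diff)
    then show ?thesis using d by (auto simp: d_def)
  qed
  have "norm ((deriv ^^ n) (bump_ext b T) (of_real x)) \<le> fact n * exp (- (2 * b / (9 * d))) / (d / 2) ^ n"
  proof (rule Cauchy_inequality)
    show "bump_ext b T holomorphic_on ball (of_real x) (d / 2)"
      using bump_ext_holomorphic by (rule holomorphic_on_subset) (use sub in force)
    show "continuous_on (cball (of_real x) (d / 2)) (bump_ext b T)"
      by (rule holomorphic_on_imp_continuous_on[OF holomorphic_on_subset[OF bump_ext_holomorphic sub]])
    show "norm (bump_ext b T \<zeta>) \<le> exp (- (2 * b / (9 * d)))" if "norm (of_real x - \<zeta>) = d / 2" for \<zeta>
      unfolding d_def by (rule bump_ext_norm_le) (use that assms in \<open>auto simp: norm_minus_commute\<close>)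
  qed (use d in simp)
  then show ?thesis by (simp add: power_divide field_simps)
qed

text \<open>
  With \<open>d\<close> the distance from \<open>x\<close> to the ends and \<open>y = 2b/(9d)\<close>, the Cauchy bound contains
  \<open>(2/d)^n exp (-y)\<close>, and \<open>2/d = (9/b) y\<close>; the bound \<open>y^n exp (-y) \<le> n!\<close> turns the singular
  power into a factorial. Spending \<open>k\<close> further factorials leaves a factor \<open>d^k\<close>: the case \<open>k = 0\<close>
  is the Gevrey bound, the case \<open>k = 1\<close> shows continuity at the ends.
\<close>

lemma bump_higher_deriv_le_power:
  assumes "b > 0" "0 < x" "x < T"
  defines "d \<equiv> min x (T - x)"
  shows "norm ((deriv ^^ n) (bump_ext b T) (of_real x)) \<le> fact n * fact (n + k) * (9 / b) ^ (n + k) * (d / 2) ^ k"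
proof -
  have d: "d > 0" using assms by (auto simp: d_def)
  define y where "y = 2 * b / (9 * d)"
  have y: "y \<ge> 0" "2 / d = (9 / b) * y" using assms d by (auto simp: y_def)
  have "norm ((deriv ^^ n) (bump_ext b T) (of_real x)) \<le> fact n * (2 / d) ^ n * exp (- y)"
    unfolding y_def d_def by (rule bump_higher_deriv_le) (use assms in auto)
  also have "(2 / d) ^ n = (2 / d) ^ (n + k) * (d / 2) ^ k"
    using d by (simp add: power_add power_divide)
  also have "(2 / d) ^ (n + k) = (9 / b) ^ (n + k) * y ^ (n + k)" by (simp only: y(2) power_mult_distrib)
  also have "fact n * ((9 / b) ^ (n + k) * y ^ (n + k) * (d / 2) ^ k) * exp (- y)
      = fact n * (y ^ (n + k) * exp (- y)) * (9 / b) ^ (n + k) * (d / 2) ^ k" by (simp add: mult_ac)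
  also have "\<dots> \<le> fact n * fact (n + k) * (9 / b) ^ (n + k) * (d / 2) ^ k"
    using assms d y by (intro mult_right_mono mult_left_mono power_times_exp_minus_le_fact) auto
  finally show ?thesis .
qed

lemma bump_deriv_norm_le:
  assumes "b > 0"
  shows "norm (bump_deriv b T n x) \<le> (fact n)\<^sup>2 * (9 / b) ^ n"
  using bump_higher_deriv_le_power[of b x T n 0] assms
  by (auto simp: bump_deriv_def power2_eq_square)

lemma bump_deriv_has_derivative:
  assumes "0 < x" "x < T"
  shows "(bump_deriv b T n has_vector_derivative bump_deriv b T (Suc n) x) (at x)"
proof -
  have "((deriv ^^ n) (bump_ext b T) has_field_derivative (deriv ^^ (Suc n)) (bump_ext b T) (of_real x)) (at (of_real x))"
    by (rule has_field_derivative_higher_deriv[OF bump_ext_holomorphic]) (use assms in auto)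
  then have "((\<lambda>x. (deriv ^^ n) (bump_ext b T) (of_real x)) has_vector_derivative (deriv ^^ (Suc n)) (bump_ext b T) (of_real x)) (at x)"
    by (rule has_vector_derivative_real_field)
  then have "(bump_deriv b T n has_vector_derivative (deriv ^^ (Suc n)) (bump_ext b T) (of_real x)) (at x)"
    by (rule has_vector_derivative_transform_within_open[of _ _ _ "{0<..<T}"])
       (use assms in \<open>auto simp: bump_deriv_def\<close>)
  then show ?thesis using assms by (simp add: bump_deriv_def)
qed

lemma bump_deriv_continuous:
  assumes "b > 0"
  shows "continuous_on {0..T} (bump_deriv b T n)"
proof -
  define K where "K = fact n * fact (Suc n) * (9 / b) ^ Suc n"
  have K: "K > 0" using assms by (simp add: K_def)
  have le: "norm (bump_deriv b T n x) \<le> K * \<bar>x - e\<bar>" if "e = 0 \<or> e = T" for x e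
  proof (cases "0 < x \<and> x < T")
    case True
    have "norm (bump_deriv b T n x) \<le> K * (min x (T - x) / 2)"
      using bump_higher_deriv_le_power[of b x T n 1] True assms by (simp add: bump_deriv_def K_def)
    also have "\<dots> \<le> K * \<bar>x - e\<bar>" using K True that by (intro mult_left_mono) auto
    finally show ?thesis .
  qed (use K in \<open>auto simp: bump_deriv_def\<close>)
  have lim: "isCont (bump_deriv b T n) e" if "e = 0 \<or> e = T" for e
  proof -
    have "((\<lambda>x. K * \<bar>x - e\<bar>) \<longlongrightarrow> K * \<bar>e - e\<bar>) (at e)" by (intro tendsto_intros)
    then have "(bump_deriv b T n \<longlongrightarrow> 0) (at e)"
      by (intro Lim_null_comparison[of "bump_deriv b T n" "\<lambda>x. K * \<bar>x - e\<bar>"] always_eventually)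
         (use le[OF that] in auto)
    moreover have "bump_deriv b T n e = 0" using that by (auto simp: bump_deriv_def)
    ultimately show ?thesis by (simp add: isCont_def)
  qed
  have "isCont (bump_deriv b T n) x" if "x \<in> {0..T}" for x
    using that lim[of x] bump_deriv_has_derivative[of x T b n]
    by (cases "x = 0 \<or> x = T") (auto intro: has_vector_derivative_continuous)
  then show ?thesis by (simp add: continuous_at_imp_continuous_on)
qed

definition bump_transform :: "real \<Rightarrow> real \<Rightarrow> complex \<Rightarrow> complex" where
  "bump_transform b T z = integral {0..T} (\<lambda>x. exp (z * of_real x) * bump_deriv b T 0 x)"

text \<open>
  Each integration by parts moves one derivative to the exponential.
\<close>

lemma has_integral_exp_bump_deriv:
  assumes "b > 0" "T > 0"
  shows "((\<lambda>x. exp (z * of_real x) * bump_deriv b T n x) has_integral (- z) ^ n * bump_transform b T z) {0..T}"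
proof (induction n)
  case 0
  have "continuous_on {0..T} (\<lambda>x. exp (z * of_real x) * bump_deriv b T 0 x)"
    by (intro continuous_intros bump_deriv_continuous assms)
  then show ?case
    by (simp add: bump_transform_def integrable_continuous_interval integrable_integral)
next
  case (Suc n)
  let ?h = "\<lambda>x. exp (z * of_real x) * bump_deriv b T n x"
  have "((\<lambda>x. exp (z * of_real x) * bump_deriv b T (Suc n) x + (z * exp (z * of_real x)) * bump_deriv b T n x)
      has_integral ?h T - ?h 0) {0..T}"
  proof (rule fundamental_theorem_of_calculus_interior)
    show "continuous_on {0..T} ?h" by (intro continuous_intros bump_deriv_continuous assms)
    fix x assume x: "x \<in> {0<..<T}"
    have "((\<lambda>w. exp (z * w)) has_field_derivative z * exp (z * of_real x)) (at (of_real x))"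
      by (auto intro!: derivative_eq_intros)
    then have "((\<lambda>x. exp (z * of_real x)) has_vector_derivative z * exp (z * of_real x)) (at x)"
      by (rule has_vector_derivative_real_field)
    then show "(?h has_vector_derivative exp (z * of_real x) * bump_deriv b T (Suc n) x
        + (z * exp (z * of_real x)) * bump_deriv b T n x) (at x)"
      by (rule has_vector_derivative_mult[OF _ bump_deriv_has_derivative]) (use x in auto)
  qed (use assms in auto)
  moreover have "?h T - ?h 0 = 0" by (simp add: bump_deriv_def)
  moreover have "((\<lambda>x. z * (exp (z * of_real x) * bump_deriv b T n x)) has_integral z * ((- z) ^ n * bump_transform b T z)) {0..T}"
    by (rule has_integral_mult_right[OF Suc])
  ultimately have "((\<lambda>x. (exp (z * of_real x) * bump_deriv b T (Suc n) x + (z * exp (z * of_real x)) * bump_deriv b T n x)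
     - z * (exp (z * of_real x) * bump_deriv b T n x)) has_integral 0 - z * ((- z) ^ n * bump_transform b T z)) {0..T}"
    by (intro has_integral_diff) auto
  then show ?case by (simp add: algebra_simps)
qed

text \<open>
  At a real point the integrand is positive, so it can be restricted to \<open>T/(4m) \<le> t \<le> T/(2m)\<close>.
  There \<open>b/t\<close> and \<open>X m^2 t\<close> are both of order \<open>m\<close>, which is the best compromise between the
  flatness of the bump at \<open>0\<close> and the decay of the exponential.
\<close>

lemma bump_transform_lower_bound:
  assumes "b > 0" "T > 0" "m \<ge> (1::real)" "X \<ge> 0" "x \<ge> - (X * m\<^sup>2)"
  shows "norm (bump_transform b T (of_real x)) \<ge>
     T / 4 * exp (- 2 * b / T) * exp (- (4 * b / T + X * T / 2 + 1) * m)"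
proof -
  let ?r = "\<lambda>t. exp (x * t) * Re (bump_deriv b T 0 t)"
  have bump: "bump_deriv b T 0 t = of_real (exp (- (b / t) - b / (T - t)))" if "0 < t" "t < T" for t
    using that by (simp add: bump_deriv_def bump_ext_def flip: exp_of_real)
  have real: "exp (of_real x * of_real t) * bump_deriv b T 0 t = of_real (?r t)" for t
  proof (cases "0 < t \<and> t < T")
    case True
    then have "bump_deriv b T 0 t = of_real (Re (bump_deriv b T 0 t))" using bump[of t] by simp
    then show ?thesis by (metis exp_of_real of_real_mult)
  qed (auto simp: bump_deriv_def)
  have pos: "?r t \<ge> 0" for t
    by (cases "0 < t \<and> t < T") (use bump[of t] in \<open>auto simp: bump_deriv_def\<close>)
  have cont: "continuous_on {0..T} ?r"
    by (intro continuous_intros bump_deriv_continuous assms)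
  have "bump_transform b T (of_real x) = integral {0..T} (\<lambda>t. of_real (?r t))"
    unfolding bump_transform_def real ..
  also have "\<dots> = of_real (integral {0..T} ?r)"
    using integral_linear[OF integrable_continuous_interval[OF cont] bounded_linear_of_real] by (simp add: o_def)
  finally have eq: "bump_transform b T (of_real x) = of_real (integral {0..T} ?r)" .
  let ?A = "{T / (4 * m)..T / (2 * m)}"
  let ?c = "exp (- (X * T / 2 * m) - 4 * b / T * m - 2 * b / T)"
  have sub: "?A \<subseteq> {0..T}" using assms by (auto simp: field_simps)
  have "?c \<le> ?r t" if t: "t \<in> ?A" for t
  proof -
    have t0: "t > 0" using t assms by (auto intro: less_le_trans[of 0 "T / (4*m)"])
    have tm: "t \<le> T / (2 * m)" "T / (4 * m) \<le> t" using t by auto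
    have "T / (2 * m) \<le> T / 2" using assms by (simp add: field_simps)
    then have tT: "t \<le> T / 2" using tm by linarith
    have "X * m\<^sup>2 * t \<le> X * m\<^sup>2 * (T / (2 * m))" using assms tm by (intro mult_left_mono) auto
    also have "\<dots> = X * T / 2 * m" using assms by (simp add: power2_eq_square)
    finally have "X * m\<^sup>2 * t \<le> X * T / 2 * m" .
    moreover have "- (X * m\<^sup>2) * t \<le> x * t" using assms t0 by (intro mult_right_mono) auto
    ultimately have 1: "x * t \<ge> - (X * T / 2 * m)" by simp
    have "b / t \<le> b / (T / (4 * m))" using assms tm t0 by (intro divide_left_mono) auto
    then have 2: "b / t \<le> 4 * b / T * m" by (simp add: mult_ac)
    have "b / (T - t) \<le> b / (T / 2)" using assms tT by (intro divide_left_mono) auto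
    then have 3: "b / (T - t) \<le> 2 * b / T" by (simp add: mult_ac)
    have "?r t = exp (x * t + (- (b / t) - b / (T - t)))"
      using bump[of t] t0 tT assms by (simp add: exp_add)
    then show ?thesis using 1 2 3 by simp
  qed
  then have "integral ?A (\<lambda>t. ?c) \<le> integral ?A ?r"
    by (intro integral_le integrable_continuous_interval continuous_on_subset[OF cont sub]) auto
  also have "\<dots> \<le> integral {0..T} ?r"
    by (intro integral_subset_le sub integrable_continuous_interval continuous_on_subset[OF cont sub] cont)
       (use pos in auto)
  also have "integral ?A (\<lambda>t. ?c) = T / (4 * m) * ?c"
    using assms by (simp add: field_simps)
  finally have "T / (4 * m) * ?c \<le> norm (bump_transform b T (of_real x))" unfolding eq by simp
  moreover have "T / 4 * exp (- 2 * b / T) * exp (- (4 * b / T + X * T / 2 + 1) * m) \<le> T / (4 * m) * ?c"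
  proof -
    have "m \<le> exp m" using exp_ge_add_one_self[of m] by linarith
    then have "exp (- m) \<le> 1 / m" using assms by (simp add: exp_minus field_simps)
    then have "T / 4 * ?c * exp (- m) \<le> T / 4 * ?c * (1 / m)" using assms by (intro mult_left_mono) auto
    moreover have "exp (- 2 * b / T) * exp (- (4 * b / T + X * T / 2 + 1) * m) = ?c * exp (- m)"
      by (simp add: algebra_simps flip: exp_add)
    ultimately show ?thesis using assms by (simp add: algebra_simps)
  qed
  ultimately show ?thesis by linarith
qed

section \<open>Functions on an interval with prescribed transform\<close>

text \<open>
  Cauchy's inequality on the circle of radius \<open>n^2\<close>, where the square root in the growth bound
  is \<open>n\<close>.
\<close>

lemma entire_coeff_bound:
  assumes "S holomorphic_on UNIV" "C \<ge> 0"
    and S: "\<And>z. norm (S z) \<le> K * exp (C * sqrt (norm z))"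
  shows "norm ((deriv ^^ n) S 0) * fact n \<le> K * exp C ^ n"
proof (cases "n = 0")
  case True
  then show ?thesis using S[of 0] by simp
next
  case False
  have K: "K \<ge> 0" using order.trans[OF norm_ge_zero S[of 0]] by simp
  have "norm ((deriv ^^ n) S 0) \<le> fact n * (K * exp (C * real n)) / ((real n)\<^sup>2) ^ n"
  proof (rule Cauchy_inequality)
    show "norm (S z) \<le> K * exp (C * real n)" if "norm (0 - z) = (real n)\<^sup>2" for z
      using S[of z] that by simp
  qed (use False assms in \<open>auto intro: holomorphic_on_subset holomorphic_on_imp_continuous_on\<close>)
  then have "norm ((deriv ^^ n) S 0) * fact n \<le> fact n * (K * exp (C * real n)) / ((real n)\<^sup>2) ^ n * fact n"
    by (intro mult_right_mono) auto
  also have "\<dots> = (fact n)\<^sup>2 / ((real n) ^ n)\<^sup>2 * (K * exp (C * real n))"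
    by (simp add: power2_eq_square power_mult_distrib)
  also have "\<dots> \<le> 1 * (K * exp (C * real n))"
  proof (intro mult_right_mono)
    have "fact n \<le> real n ^ n" using fact_le_power[of n, where 'a = real] by simp
    then have "(fact n)\<^sup>2 \<le> ((real n) ^ n)\<^sup>2" by (intro power_mono) auto
    then show "(fact n)\<^sup>2 / ((real n) ^ n)\<^sup>2 \<le> 1" using False by (simp add: divide_le_eq)
  qed (use K in auto)
  also have "exp (C * real n) = exp C ^ n" by (simp add: exp_of_nat2_mult)
  finally show ?thesis by simp
qed

text \<open>
  The function is the sum of the series of \<open>(-1)^n p_n \<psi>^(n)\<close>, where \<open>S\<close> has the Taylor coefficients
  \<open>p_n\<close>. The choice of \<open>b\<close> makes the terms at most \<open>K / 2^n\<close>; this is the only place where the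
  growth constant \<open>C\<close> and the bump have to match.
\<close>

lemma exists_continuous_with_transform:
  assumes T: "T > 0" and C: "C \<ge> 0"
    and S: "S holomorphic_on UNIV" "\<And>z. norm (S z) \<le> K * exp (C * sqrt (norm z))"
  defines "b \<equiv> 18 * exp C"
  shows "\<exists>f. continuous_on {0..T} f \<and> (\<forall>x. norm (f x) \<le> 2 * K) \<and>
     (\<forall>z. ((\<lambda>x. exp (z * of_real x) * f x) has_integral S z * bump_transform b T z) {0..T})"
proof -
  have K: "K \<ge> 0" using order.trans[OF norm_ge_zero S(2)[of 0]] by simp
  have b: "b > 0" by (simp add: b_def)
  define p where "p n = (deriv ^^ n) S 0 / fact n" for n
  define u where "u n x = (- 1) ^ n * p n * bump_deriv b T n x" for n x
  have S_sums: "(\<lambda>n. p n * z ^ n) sums S z" for z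
    using holomorphic_power_series[OF holomorphic_on_subset[OF S(1)], of 0 "norm z + 1" z]
    by (simp add: p_def)
  have u_le: "norm (u n x) \<le> K * (1 / 2) ^ n" for n x
  proof -
    have "norm (u n x) = norm (p n) * norm (bump_deriv b T n x)"
      by (simp add: u_def norm_mult norm_power)
    also have "\<dots> \<le> norm (p n) * ((fact n)\<^sup>2 * (9 / b) ^ n)"
      by (intro mult_left_mono bump_deriv_norm_le b) auto
    also have "\<dots> = (norm ((deriv ^^ n) S 0) * fact n) * (9 / b) ^ n"
      by (simp add: p_def norm_divide power2_eq_square)
    also have "\<dots> \<le> (K * exp C ^ n) * (9 / b) ^ n"
      by (intro mult_right_mono entire_coeff_bound S C) (use b in auto)
    also have "\<dots> = K * (1 / 2) ^ n"
    proof -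
      have "exp C * (9 / b) = 1 / 2" by (simp add: b_def)
      then show ?thesis by (metis mult.assoc power_mult_distrib)
    qed
    finally show ?thesis .
  qed
  have geo: "summable (\<lambda>n. K * (1 / 2) ^ n)" by (intro summable_mult summable_geometric) simp
  have summ: "summable (\<lambda>n. u n x)" for x
    by (rule summable_comparison_test'[OF geo]) (use u_le in auto)
  define f where "f x = (\<Sum>n. u n x)" for x
  have u_cont: "continuous_on {0..T} (u n)" for n
    unfolding u_def by (intro continuous_intros bump_deriv_continuous b)
  have f_lim: "uniform_limit {0..T} (\<lambda>n x. \<Sum>i<n. u i x) f sequentially"
    unfolding f_def by (rule Weierstrass_m_test[OF u_le geo])
  have f_cont: "continuous_on {0..T} f"
    by (rule uniform_limit_theorem[OF _ f_lim]) (intro always_eventually allI continuous_on_sum u_cont, simp)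
  have f_le: "norm (f x) \<le> 2 * K" for x
  proof -
    have "norm (f x) \<le> (\<Sum>n. K * (1 / 2) ^ n)"
      unfolding f_def by (rule norm_suminf_le[OF u_le geo])
    then show ?thesis by (simp add: suminf_mult suminf_geometric summable_geometric)
  qed
  have int: "((\<lambda>x. exp (z * of_real x) * f x) has_integral S z * bump_transform b T z) {0..T}" for z
  proof -
    let ?e = "\<lambda>x::real. exp (z * of_real x)"
    have ec: "continuous_on {0..T} ?e" by (intro continuous_intros)
    have bounded: "bounded (?e ` {0..T})" "bounded (f ` {0..T})"
      by (intro compact_imp_bounded compact_continuous_image ec f_cont; simp)+
    have "uniform_limit {0..T} (\<lambda>n x. ?e x * (\<Sum>i<n. u i x)) (\<lambda>x. ?e x * f x) sequentially"
      by (intro uniform_lim_mult uniform_limit_const f_lim bounded)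
    then obtain I J where IJ: "\<And>n. ((\<lambda>x. ?e x * (\<Sum>i<n. u i x)) has_integral I n) {0..T}"
        "((\<lambda>x. ?e x * f x) has_integral J) {0..T}" "I \<longlonglongrightarrow> J"
      by (rule uniform_limit_integral) (auto intro!: continuous_intros u_cont)
    have "((\<lambda>x. ?e x * (\<Sum>i<n. u i x)) has_integral (\<Sum>i<n. p i * z ^ i * bump_transform b T z)) {0..T}" for n
    proof -
      have "((\<lambda>x. \<Sum>i<n. ((- 1) ^ i * p i) * (?e x * bump_deriv b T i x)) has_integral
          (\<Sum>i<n. ((- 1) ^ i * p i) * ((- z) ^ i * bump_transform b T z))) {0..T}"
        by (intro has_integral_sum has_integral_mult_right has_integral_exp_bump_deriv b T) simp
      moreover have "((- 1) ^ i * p i) * ((- z) ^ i * bump_transform b T z) = p i * z ^ i * bump_transform b T z" for i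
        by (simp add: mult_ac flip: power_mult_distrib)
      moreover have "(\<Sum>i<n. ((- 1) ^ i * p i) * (?e x * bump_deriv b T i x)) = ?e x * (\<Sum>i<n. u i x)" for x
        by (simp add: u_def sum_distrib_left mult_ac)
      ultimately show ?thesis by (simp only:)
    qed
    then have "I = (\<lambda>n. \<Sum>i<n. p i * z ^ i * bump_transform b T z)"
      using IJ(1) by (intro ext has_integral_unique)
    moreover have "(\<lambda>i. p i * z ^ i * bump_transform b T z) sums (S z * bump_transform b T z)"
      by (intro sums_mult2 S_sums)
    ultimately have "J = S z * bump_transform b T z"
      using IJ(3) by (auto simp: sums_def intro: LIMSEQ_unique)
    then show ?thesis using IJ(2) by simp
  qed
  show ?thesis using f_cont f_le int by blast
qed

section \<open>Moments and biorthogonal chains\<close>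

definition moment :: "real \<Rightarrow> (real \<Rightarrow> complex) \<Rightarrow> complex \<Rightarrow> nat \<Rightarrow> complex" where
  "moment T f z r = integral {0..T} (\<lambda>x. of_real x ^ r * exp (z * of_real x) * f x)"

lemma moment_integrable:
  fixes f :: "real \<Rightarrow> complex"
  shows "continuous_on {0..T} f \<Longrightarrow> (\<lambda>x. of_real x ^ r * exp (z * of_real x) * f x) integrable_on {0..T}"
  by (intro integrable_continuous_interval continuous_intros)

lemma moment_linear:
  assumes "continuous_on {0..T} f" "finite I" "\<And>i. i \<in> I \<Longrightarrow> continuous_on {0..T} (g i)"
  shows "moment T (\<lambda>x. c * (f x - (\<Sum>i\<in>I. a i * g i x))) z r
     = c * (moment T f z r - (\<Sum>i\<in>I. a i * moment T (g i) z r))"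
proof -
  let ?k = "\<lambda>x. of_real x ^ r * exp (z * of_real x) :: complex"
  have "((\<lambda>x. c * (?k x * f x - (\<Sum>i\<in>I. a i * (?k x * g i x)))) has_integral
      c * (moment T f z r - (\<Sum>i\<in>I. a i * moment T (g i) z r))) {0..T}"
    unfolding moment_def
    by (intro has_integral_mult_right has_integral_diff has_integral_sum integrable_integral moment_integrable assms)
  also have "(\<lambda>x. c * (?k x * f x - (\<Sum>i\<in>I. a i * (?k x * g i x))))
     = (\<lambda>x. ?k x * (c * (f x - (\<Sum>i\<in>I. a i * g i x))))"
    by (simp add: algebra_simps sum_distrib_left)
  finally show ?thesis unfolding moment_def by (rule integral_unique)
qed

lemma moment_has_field_derivative:
  assumes f: "continuous_on {0..T} f"
  shows "((\<lambda>z. moment T f z r) has_field_derivative moment T f z (Suc r)) (at z)"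
proof -
  have "((\<lambda>z. integral (cbox 0 T) (\<lambda>x. of_real x ^ r * exp (z * of_real x) * f x)) has_field_derivative
      integral (cbox 0 T) (\<lambda>x. of_real x ^ Suc r * exp (z * of_real x) * f x)) (at z within UNIV)"
  proof (rule leibniz_rule_field_derivative)
    show "((\<lambda>z. of_real x ^ r * exp (z * of_real x) * f x) has_field_derivative
        of_real x ^ Suc r * exp (z * of_real x) * f x) (at z within UNIV)" for x z
      by (auto intro!: derivative_eq_intros)
    show "(\<lambda>x. of_real x ^ r * exp (z * of_real x) * f x) integrable_on cbox 0 T" for z
      using moment_integrable[OF f] by simp
    have "continuous_on (UNIV \<times> cbox 0 T) (\<lambda>y :: complex \<times> real. f (snd y))"
      by (rule continuous_on_compose2[OF f]) (auto intro!: continuous_intros)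
    then show "continuous_on (UNIV \<times> cbox 0 T) (\<lambda>(z :: complex, x). of_real x ^ Suc r * exp (z * of_real x) * f x)"
      unfolding case_prod_unfold by (intro continuous_intros)
  qed auto
  then show ?thesis by (simp add: moment_def)
qed

lemma higher_deriv_transform_eq_moment:
  assumes f: "continuous_on {0..T} f"
  shows "(deriv ^^ r) (\<lambda>z. integral {0..T} (\<lambda>x. exp (z * of_real x) * f x)) z = moment T f z r"
proof (induction r arbitrary: z)
  case 0
  then show ?case by (simp add: moment_def)
next
  case (Suc r)
  have "deriv (\<lambda>z. moment T f z r) z = moment T f z (Suc r)"
    by (rule DERIV_imp_deriv[OF moment_has_field_derivative[OF f]])
  moreover have "(deriv ^^ r) (\<lambda>z. integral {0..T} (\<lambda>x. exp (z * of_real x) * f x)) = (\<lambda>z. moment T f z r)"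
    using Suc.IH by blast
  ultimately show ?case by simp
qed

text \<open>
  A zero of order at least \<open>e\<close>, expressed by an entire cofactor so that it passes to products.
\<close>

definition vanishes_to_order :: "(complex \<Rightarrow> complex) \<Rightarrow> complex \<Rightarrow> nat \<Rightarrow> bool" where
  "vanishes_to_order R v e \<longleftrightarrow> (\<exists>H. H holomorphic_on UNIV \<and> (\<forall>z. R z = (z - v) ^ e * H z))"

lemma vanishes_to_order_power: "vanishes_to_order (\<lambda>z. (z - v) ^ e) v e"
  unfolding vanishes_to_order_def by (intro exI[of _ "\<lambda>z. 1"]) auto

lemma vanishes_to_order_mult:
  assumes "vanishes_to_order f v e" "g holomorphic_on UNIV"
  shows "vanishes_to_order (\<lambda>z. f z * g z) v e" "vanishes_to_order (\<lambda>z. g z * f z) v e"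
proof -
  obtain H where H: "H holomorphic_on UNIV" "\<And>z. f z = (z - v) ^ e * H z"
    using assms(1) by (auto simp: vanishes_to_order_def)
  have "(\<lambda>z. H z * g z) holomorphic_on UNIV" by (intro holomorphic_intros H assms)
  then show "vanishes_to_order (\<lambda>z. f z * g z) v e" "vanishes_to_order (\<lambda>z. g z * f z) v e"
    unfolding vanishes_to_order_def H(2) by (auto intro!: exI[of _ "\<lambda>z. H z * g z"] simp: mult_ac)
qed

lemma higher_deriv_factor:
  assumes "H holomorphic_on UNIV" "r \<le> e"
  shows "(deriv ^^ r) (\<lambda>z. (z - v) ^ e * H z) v = (if r = e then fact e * H v else 0)"
proof -
  have d: "(deriv ^^ j) (\<lambda>z. (z - v) ^ e) v = (if j = e then fact e else 0)" if "j \<le> e" for j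
    using that unfolding higher_deriv_power by (auto simp: pochhammer_fact)
  have "(deriv ^^ r) (\<lambda>z. (z - v) ^ e * H z) v
      = (\<Sum>i = 0..r. of_nat (r choose i) * (deriv ^^ i) (\<lambda>z. (z - v) ^ e) v * (deriv ^^ (r - i)) H v)"
    by (rule higher_deriv_mult) (use assms in \<open>auto intro!: holomorphic_intros\<close>)
  also have "\<dots> = (\<Sum>i = 0..r. if i = e then fact e * H v else 0)"
    by (rule sum.cong) (use assms d in auto)
  finally show ?thesis using assms by auto
qed

text \<open>
  Back substitution, from \<open>q = d - 1\<close> down: subtract from \<open>f q\<close> its components along the functions
  already found and divide by the diagonal entry. Each step multiplies the norms by at most
  \<open>(1 + d) B^2\<close>. The result consists of linear combinations of the \<open>f q\<close>, so it inherits the moments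
  that vanish for all of them.
\<close>

lemma triangular_biorthogonalization:
  fixes B :: real
  assumes B: "B \<ge> 1"
    and f: "\<And>q. q < d \<Longrightarrow> continuous_on {0..T} (f q)"
    and f_le: "\<And>q x. q < d \<Longrightarrow> x \<in> {0..T} \<Longrightarrow> norm (f q x) \<le> B"
    and zero: "\<And>q r. q < d \<Longrightarrow> r < q \<Longrightarrow> moment T (f q) w r = 0"
    and diag: "\<And>q. q < d \<Longrightarrow> norm (moment T (f q) w q) \<ge> 1 / B"
    and upper: "\<And>q r. q < d \<Longrightarrow> r < d \<Longrightarrow> norm (moment T (f q) w r) \<le> B"
  shows "\<exists>g. \<forall>q<d. continuous_on {0..T} (g q) \<and>
     (\<forall>x\<in>{0..T}. norm (g q x) \<le> ((1 + real d) * B\<^sup>2) ^ d) \<and>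
     (\<forall>r<d. moment T (g q) w r = (if q = r then 1 else 0)) \<and>
     (\<forall>v r. (\<forall>q<d. moment T (f q) v r = 0) \<longrightarrow> moment T (g q) v r = 0)"
proof -
  define D where "D = (1 + real d) * B\<^sup>2"
  have "1 * 1 \<le> (1 + real d) * B\<^sup>2"
    using B by (intro mult_mono one_le_power) auto
  then have D: "D \<ge> 1" by (simp add: D_def)
  have "k \<le> d \<Longrightarrow> \<exists>g. \<forall>q\<in>{d-k..<d}. continuous_on {0..T} (g q) \<and>
     (\<forall>x\<in>{0..T}. norm (g q x) \<le> D ^ k) \<and>
     (\<forall>r<d. moment T (g q) w r = (if q = r then 1 else 0)) \<and>
     (\<forall>v r. (\<forall>q<d. moment T (f q) v r = 0) \<longrightarrow> moment T (g q) v r = 0)" for k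
  proof (induction k)
    case 0
    then show ?case by simp
  next
    case (Suc k)
    then obtain g where g: "\<forall>q\<in>{d-k..<d}. continuous_on {0..T} (g q) \<and>
     (\<forall>x\<in>{0..T}. norm (g q x) \<le> D ^ k) \<and>
     (\<forall>r<d. moment T (g q) w r = (if q = r then 1 else 0)) \<and>
     (\<forall>v r. (\<forall>q<d. moment T (f q) v r = 0) \<longrightarrow> moment T (g q) v r = 0)" by auto
    define q0 where "q0 = d - Suc k"
    have q0: "q0 < d" "{d-k..<d} = {Suc q0..<d}" using Suc.prems by (auto simp: q0_def)
    define c where "c = 1 / moment T (f q0) w q0"
    define h where "h x = c * (f q0 x - (\<Sum>i\<in>{Suc q0..<d}. moment T (f q0) w i * g i x))" for x
    have "norm (moment T (f q0) w q0) > 0"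
      by (rule less_le_trans[of 0 "1 / B"]) (use diag[OF q0(1)] B in auto)
    then have c: "norm c \<le> B" "c * moment T (f q0) w q0 = 1"
      using diag[OF q0(1)] B by (auto simp: c_def norm_divide field_simps)
    have g': "continuous_on {0..T} (g i)" "\<And>x. x \<in> {0..T} \<Longrightarrow> norm (g i x) \<le> D ^ k"
       "\<And>r. r < d \<Longrightarrow> moment T (g i) w r = (if i = r then 1 else 0)"
       "\<And>v r. (\<forall>q<d. moment T (f q) v r = 0) \<Longrightarrow> moment T (g i) v r = 0" if "i \<in> {Suc q0..<d}" for i
      using g that unfolding q0(2) by blast+
    have mom: "moment T h v r = c * (moment T (f q0) v r - (\<Sum>i\<in>{Suc q0..<d}. moment T (f q0) w i * moment T (g i) v r))" for v r
      unfolding h_def by (rule moment_linear) (use f q0 g' in auto)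
    have h1: "continuous_on {0..T} h"
      unfolding h_def by (intro continuous_intros f q0 g')
    have h2: "norm (h x) \<le> D ^ Suc k" if x: "x \<in> {0..T}" for x
    proof -
      have "norm (\<Sum>i\<in>{Suc q0..<d}. moment T (f q0) w i * g i x) \<le> (\<Sum>i\<in>{Suc q0..<d}. B * D ^ k)"
        using upper q0 g' x B by (intro sum_norm_le) (auto simp: norm_mult intro!: mult_mono)
      also have "\<dots> \<le> real d * (B * D ^ k)" using B D by (auto intro!: mult_right_mono)
      finally have "norm (f q0 x - (\<Sum>i\<in>{Suc q0..<d}. moment T (f q0) w i * g i x)) \<le> B + real d * (B * D ^ k)"
        using f_le[OF q0(1) x] by (intro order.trans[OF norm_triangle_ineq4] add_mono)
      also have "B + real d * (B * D ^ k) \<le> B * D ^ k + real d * (B * D ^ k)"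
        using B D by simp
      finally have "norm (h x) \<le> B * (B * D ^ k + real d * (B * D ^ k))"
        unfolding h_def norm_mult using B c by (intro mult_mono) auto
      also have "\<dots> = D ^ Suc k" by (simp add: D_def power2_eq_square algebra_simps)
      finally show ?thesis .
    qed
    have h3: "moment T h w r = (if q0 = r then 1 else 0)" if r: "r < d" for r
    proof -
      have "(\<Sum>i\<in>{Suc q0..<d}. moment T (f q0) w i * moment T (g i) w r)
          = (\<Sum>i\<in>{Suc q0..<d}. if i = r then moment T (f q0) w r else 0)"
        using g' r by (intro sum.cong) auto
      also have "\<dots> = (if r > q0 then moment T (f q0) w r else 0)" using r by auto
      finally show ?thesis using zero[OF q0(1), of r] c by (auto simp: mom)
    qed
    have h4: "moment T h v r = 0" if "\<forall>q<d. moment T (f q) v r = 0" for v r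
      using that g' q0 by (simp add: mom)
    have Dk: "D ^ k \<le> D ^ Suc k" using D by (intro power_increasing) auto
    have "{d - Suc k..<d} = insert q0 {Suc q0..<d}" using q0 by (auto simp: q0_def)
    then show ?case
      using h1 h2 h3 h4 g' order.trans[OF g'(2) Dk]
      by (intro exI[of _ "g(q0 := h)"]) auto
  qed
  from this[OF order.refl] show ?thesis
    unfolding D_def by (simp only: diff_self_eq_0 atLeast0LessThan Ball_def lessThan_iff)
qed

lemma power2_le_two_exp: "m \<ge> (0::real) \<Longrightarrow> m\<^sup>2 \<le> 2 * exp m"
  using exp_lower_Taylor_quadratic[of m] by simp

lemma le_two_exp_sqrt: "x \<ge> (0::real) \<Longrightarrow> x \<le> 2 * exp (sqrt x)"
  using power2_le_two_exp[of "sqrt x"] by simp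

lemma moment_eq_0:
  assumes f: "continuous_on {0..T} f" and H: "H holomorphic_on UNIV"
    and eq: "\<And>z. integral {0..T} (\<lambda>x. exp (z * of_real x) * f x) = (z - v) ^ e * H z"
    and "r < e"
  shows "moment T f v r = 0"
  using higher_deriv_transform_eq_moment[OF f, of r v] higher_deriv_factor[OF H, of r e v] \<open>r < e\<close>
  unfolding eq by simp

lemma moment_norm_le:
  assumes f: "continuous_on {0..T} f" and T: "T > 0"
    and le: "\<And>x. x \<in> {0..T} \<Longrightarrow> norm (f x) \<le> B" and "B \<ge> 0" and "Re w \<le> X" "X \<ge> 0" "r \<le> d"
  shows "norm (moment T f w r) \<le> B * exp (X * T) * (1 + T) ^ d * T"
proof -
  have "norm (integral (cbox 0 T) (\<lambda>x. of_real x ^ r * exp (w * of_real x) * f x))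
       \<le> (B * exp (X * T) * (1 + T) ^ d) * Henstock_Kurzweil_Integration.content (cbox 0 T)"
  proof (rule integrable_bound)
    show "(\<lambda>x. of_real x ^ r * exp (w * of_real x) * f x) integrable_on cbox 0 T"
      using moment_integrable[OF f] by simp
    fix x assume x: "x \<in> cbox 0 T"
    have "x ^ r \<le> (1 + T) ^ r" using x by (intro power_mono) auto
    also have "\<dots> \<le> (1 + T) ^ d" using assms by (intro power_increasing) auto
    finally have 1: "x ^ r \<le> (1 + T) ^ d" .
    have "Re w * x \<le> X * T"
      using x assms by (intro order.trans[OF mult_right_mono[of "Re w" X x]] mult_left_mono) auto
    then have "norm (of_real x ^ r * exp (w * of_real x) * f x) \<le> (1 + T) ^ d * exp (X * T) * B"
      unfolding norm_mult norm_power
      using 1 x le[of x] assms by (intro mult_mono) (auto simp: norm_exp_eq_Re)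
    then show "norm (of_real x ^ r * exp (w * of_real x) * f x) \<le> B * exp (X * T) * (1 + T) ^ d"
      by (simp add: mult_ac)
  qed (use assms in auto)
  then show ?thesis using T by (simp add: moment_def mult_ac)
qed

text \<open>
  One target root \<open>w\<close> of size \<open>m^2\<close>, and an entire function \<open>R\<close> carrying the zeros. The constant
  \<open>D\<close> is chosen before \<open>m\<close>, \<open>w\<close> and \<open>R\<close>; this is what makes the final estimate uniform.
\<close>

lemma exists_biorthogonal_chain:
  fixes T C X K c :: real and d :: nat
  assumes T: "T > 0" and C: "C \<ge> 0" and X: "X \<ge> 0" and K: "K > 0" and c: "c > 0"
  obtains D where "D > 0"
    "\<And>m w R. \<lbrakk>m \<ge> 1; norm w \<le> X * m\<^sup>2; Re w \<le> X; R holomorphic_on UNIV;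
        \<forall>z. norm (R z) \<le> K * exp (C * (sqrt (norm z) + m)); norm (R w) \<ge> c * exp (- C * m)\<rbrakk>
      \<Longrightarrow> \<exists>g. \<forall>q<d. continuous_on {0..T} (g q) \<and>
            (\<forall>x\<in>{0..T}. norm (g q x) \<le> D * exp (D * m)) \<and>
            (\<forall>r<d. moment T (g q) w r = (if q = r then 1 else 0)) \<and>
            (\<forall>v r e. vanishes_to_order R v e \<longrightarrow> r < e \<longrightarrow> moment T (g q) v r = 0)"
proof -
  (* C1 and K1: growth of (z - w)^q R(z); b: the bump that matches C1; C2: cost of the
     shift by Im w; c3 and C3: lower bound for the bump transform; K2 and C4: one bound
     for the norms, the moments and the inverse diagonal entries. *)
  define C1 where "C1 = C + d"
  define K1 where "K1 = (2 * (1 + X)) ^ d * K"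
  define b where "b = 18 * exp C1"
  define C2 where "C2 = C1 * (1 + sqrt X)"
  define c3 where "c3 = T / 4 * exp (- 2 * b / T)"
  define C3 where "C3 = 4 * b / T + X * T / 2 + 1"
  define K2 where "K2 = 1 + 2 * K1 + 2 * K1 * exp (X * T) * (1 + T) ^ d * T + 1 / (c * c3)"
  define C4 where "C4 = C2 + C + C3"
  have pos: "C1 \<ge> 0" "K1 > 0" "b > 0" "C2 \<ge> 0" "c3 > 0" "C3 \<ge> 0" "K2 \<ge> 1" "C4 \<ge> 0"
    "2 * K1 \<le> K2" "2 * K1 * exp (X * T) * (1 + T) ^ d * T \<le> K2" "1 / (c * c3) \<le> K2"
  proof -
    show "C1 \<ge> 0" using C by (simp add: C1_def)
    then show "C2 \<ge> 0" using X by (simp add: C2_def)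
    show "K1 > 0" using X K by (simp add: K1_def)
    show "b > 0" by (simp add: b_def)
    show "c3 > 0" using T by (simp add: c3_def)
    show "C3 \<ge> 0" using T X \<open>b > 0\<close> by (simp add: C3_def)
    then show "C4 \<ge> 0" using C \<open>C2 \<ge> 0\<close> by (simp add: C4_def)
    have "2 * K1 * exp (X * T) * (1 + T) ^ d * T \<ge> 0" "1 / (c * c3) \<ge> 0"
      using T \<open>K1 > 0\<close> c \<open>c3 > 0\<close> by auto
    then show "K2 \<ge> 1" "2 * K1 \<le> K2" "2 * K1 * exp (X * T) * (1 + T) ^ d * T \<le> K2" "1 / (c * c3) \<le> K2"
      using \<open>K1 > 0\<close> by (auto simp: K2_def)
  qed
  define D where "D = ((1 + real d) * K2\<^sup>2) ^ d + 2 * real d * C4"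
  show thesis
  proof
    have "((1 + real d) * K2\<^sup>2) ^ d > 0" using pos by (intro zero_less_power mult_pos_pos) auto
    then show "D > 0" using pos by (auto simp: D_def intro: add_pos_nonneg)
    fix m :: real and w :: complex and R
    assume m: "m \<ge> 1" and w: "norm w \<le> X * m\<^sup>2" and Rew: "Re w \<le> X" and R: "R holomorphic_on UNIV"
      and R_le': "\<forall>z. norm (R z) \<le> K * exp (C * (sqrt (norm z) + m))"
      and R_ge: "norm (R w) \<ge> c * exp (- C * m)"
    note R_le = R_le'[rule_format]
    define \<beta> where "\<beta> = Im w"
    define S where "S q z = (z + \<i> * \<beta> - w) ^ q * R (z + \<i> * \<beta>)" for q z
    have \<beta>: "\<bar>\<beta>\<bar> \<le> X * m\<^sup>2" using abs_Im_le_cmod[of w] w by (simp add: \<beta>_def)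
    \<comment> \<open>shifting the argument by \<open>Im w = O(m^2)\<close> changes \<open>sqrt |z|\<close> by \<open>O(m)\<close>\<close>
    have sqrt_shift: "sqrt (norm (z + \<i> * \<beta>)) \<le> sqrt (norm z) + sqrt X * m" for z
    proof -
      have "norm (z + \<i> * \<beta>) \<le> norm z + X * m\<^sup>2"
        using \<beta> by (intro order.trans[OF norm_triangle_ineq]) (simp add: norm_mult)
      then have "sqrt (norm (z + \<i> * \<beta>)) \<le> sqrt (norm z + X * m\<^sup>2)" by simp
      also have "\<dots> \<le> sqrt (norm z) + sqrt (X * m\<^sup>2)" using X by (intro sqrt_add_le_add_sqrt) auto
      finally show ?thesis using m by (simp add: real_sqrt_mult)
    qed
    have S_le: "norm (S q z) \<le> (K1 * exp (C2 * m)) * exp (C1 * sqrt (norm z))" if q: "q < d" for q z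
    proof -
      define y where "y = z + \<i> * \<beta>"
      define s where "s = sqrt (norm y) + m"
      have s: "s \<ge> 0" using m by (simp add: s_def)
      have "norm (y - w) \<le> norm y + X * m\<^sup>2"
        using w by (intro order.trans[OF norm_triangle_ineq4]) simp
      also have "\<dots> \<le> 2 * exp (sqrt (norm y)) + X * (2 * exp m)"
        using m X by (intro add_mono mult_left_mono le_two_exp_sqrt power2_le_two_exp) auto
      also have "\<dots> \<le> 2 * exp s + X * (2 * exp s)"
        using m X by (intro add_mono mult_left_mono) (auto simp: s_def)
      finally have "norm (y - w) \<le> 2 * (1 + X) * exp s" by (simp add: algebra_simps)
      then have "norm (y - w) ^ q \<le> (2 * (1 + X) * exp s) ^ q" by (intro power_mono) auto
      also have "\<dots> \<le> (2 * (1 + X) * exp s) ^ d"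
      proof (rule power_increasing)
        have "1 * 1 \<le> 2 * (1 + X) * exp s" using s X by (intro mult_mono) auto
        then show "1 \<le> 2 * (1 + X) * exp s" by simp
      qed (use q in auto)
      also have "\<dots> = (2 * (1 + X)) ^ d * exp (d * s)" by (simp add: power_mult_distrib exp_of_nat_mult)
      finally have "norm (S q z) \<le> ((2 * (1 + X)) ^ d * exp (d * s)) * (K * exp (C * s))"
        unfolding S_def norm_mult norm_power
        using R_le[of y] X by (intro mult_mono) (auto simp: y_def s_def)
      also have "\<dots> = K1 * exp (C1 * s)" by (simp add: K1_def C1_def algebra_simps exp_add)
      also have "\<dots> \<le> K1 * exp (C2 * m + C1 * sqrt (norm z))"
      proof -
        have "C1 * s \<le> C1 * (sqrt (norm z) + sqrt X * m + m)"
          using sqrt_shift[of z] pos by (intro mult_left_mono) (auto simp: s_def y_def)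
        then show ?thesis using pos by (simp add: C2_def algebra_simps)
      qed
      finally show ?thesis by (simp add: exp_add mult_ac)
    qed
    define Q where "Q q f \<longleftrightarrow> continuous_on {0..T} f \<and> (\<forall>x. norm (f x) \<le> 2 * (K1 * exp (C2 * m))) \<and>
       (\<forall>z. ((\<lambda>x. exp (z * of_real x) * f x) has_integral S q z * bump_transform b T z) {0..T})" for q f
    have ex: "\<exists>f. Q q f" if "q < d" for q
      unfolding b_def Q_def
    proof (rule exists_continuous_with_transform)
      show "S q holomorphic_on UNIV"
      proof -
        have "(\<lambda>z. z + \<i> * \<beta>) holomorphic_on UNIV" by (intro holomorphic_intros)
        from holomorphic_on_compose_gen[OF this R] have "(\<lambda>z. R (z + \<i> * \<beta>)) holomorphic_on UNIV"
          by (simp add: o_def)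
        then show ?thesis unfolding S_def by (intro holomorphic_intros)
      qed
    qed (use T pos S_le[OF that] in auto)
    define f where "f q = (SOME f. Q q f)" for q
    have "Q q (f q)" if "q < d" for q unfolding f_def by (rule someI_ex[OF ex[OF that]])
    then have f: "continuous_on {0..T} (f q)" "norm (f q x) \<le> 2 * (K1 * exp (C2 * m))"
        "((\<lambda>x. exp (z * of_real x) * f q x) has_integral S q z * bump_transform b T z) {0..T}"
      if "q < d" for q x z using that unfolding Q_def by blast+
    define h where "h q x = exp (- \<i> * \<beta> * of_real x) * f q x" for q x
    have h_cont: "continuous_on {0..T} (h q)" if "q < d" for q
      unfolding h_def by (intro continuous_intros f that)
    have h_le: "norm (h q x) \<le> 2 * K1 * exp (C2 * m)" if "q < d" for q x
      using f(2)[OF that, of x] by (simp add: h_def norm_mult norm_exp_eq_Re mult.assoc)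
    define \<Psi> where "\<Psi> z = bump_transform b T (z - \<i> * \<beta>)" for z
    have h_int: "integral {0..T} (\<lambda>x. exp (z * of_real x) * h q x) = (z - w) ^ q * (R z * \<Psi> z)" if "q < d" for q z
    proof -
      have "exp (z * of_real x) * h q x = exp ((z - \<i> * \<beta>) * of_real x) * f q x" for x
      proof -
        have "exp (z * of_real x) * exp (- \<i> * \<beta> * of_real x) = exp ((z - \<i> * \<beta>) * of_real x)"
          by (simp add: left_diff_distrib flip: exp_add)
        then show ?thesis unfolding h_def by (metis mult.assoc)
      qed
      moreover have "S q (z - \<i> * \<beta>) = (z - w) ^ q * R z" by (simp add: S_def)
      ultimately show ?thesis
        using integral_unique[OF f(3)[OF that, of "z - \<i> * \<beta>"]] by (simp add: \<Psi>_def)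
    qed
    have \<Psi>_hol: "\<Psi> holomorphic_on UNIV"
    proof -
      have "(\<lambda>z. moment T (bump_deriv b T 0) z 0) holomorphic_on UNIV"
        using moment_has_field_derivative[OF bump_deriv_continuous[OF pos(3)]]
        unfolding holomorphic_on_open[OF open_UNIV] by blast
      then have "bump_transform b T holomorphic_on UNIV"
        by (simp add: moment_def bump_transform_def[abs_def])
      moreover have "(\<lambda>z. z - \<i> * \<beta>) holomorphic_on UNIV" by (intro holomorphic_intros)
      ultimately show ?thesis
        using holomorphic_on_compose_gen[of "\<lambda>z. z - \<i> * \<beta>" UNIV "bump_transform b T" UNIV]
        by (simp add: o_def \<Psi>_def[abs_def])
    qed
    have RPsi: "(\<lambda>z. R z * \<Psi> z) holomorphic_on UNIV" by (intro holomorphic_intros R \<Psi>_hol)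
    define B where "B = K2 * exp (C4 * m)"
    have h_B: "norm (h q x) \<le> B" if "q < d" for q x
    proof -
      have "2 * K1 * exp (C2 * m) \<le> K2 * exp (C4 * m)"
        using pos C m by (intro mult_mono) (auto simp: C4_def)
      then show ?thesis using h_le[OF that, of x] by (simp add: B_def)
    qed
    have h_diag: "norm (moment T (h q) w q) \<ge> 1 / B" if q: "q < d" for q
    proof -
      have "moment T (h q) w q = fact q * (R w * \<Psi> w)"
        using higher_deriv_transform_eq_moment[OF h_cont[OF q], of q w] higher_deriv_factor[OF RPsi, of q q w]
        unfolding h_int[OF q] by simp
      then have 1: "norm (moment T (h q) w q) = fact q * (norm (R w) * norm (\<Psi> w))" by (simp add: norm_mult)
      \<comment> \<open>the point of the shift: the bump transform is evaluated on the real axis\<close>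
      have "w - \<i> * \<beta> = of_real (Re w)" by (simp add: \<beta>_def complex_eq_iff)
      moreover have "Re w \<ge> - (X * m\<^sup>2)" using abs_Re_le_cmod[of w] w by linarith
      ultimately have \<Psi>w: "norm (\<Psi> w) \<ge> c3 * exp (- C3 * m)"
        unfolding \<Psi>_def c3_def C3_def using pos T m X by (simp only:) (intro bump_transform_lower_bound, auto)
      have "1 / B = 1 / K2 * exp (- C4 * m)" by (simp add: B_def exp_minus divide_inverse)
      also have "\<dots> \<le> (c * c3) * exp (- C * m - C3 * m)"
      proof (intro mult_mono)
        show "1 / K2 \<le> c * c3" using pos c by (simp add: field_simps)
        show "exp (- C4 * m) \<le> exp (- C * m - C3 * m)" using pos m by (simp add: C4_def algebra_simps)
      qed (use pos c in auto)
      also have "\<dots> = 1 * (c * exp (- C * m) * (c3 * exp (- C3 * m)))" by (simp add: exp_add exp_diff exp_minus field_simps)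
      also have "\<dots> \<le> fact q * (norm (R w) * norm (\<Psi> w))"
        using pos c \<Psi>w R_ge by (intro mult_mono mult_nonneg_nonneg) auto
      finally show ?thesis using 1 by simp
    qed
    have h_upper: "norm (moment T (h q) w r) \<le> B" if "q < d" "r < d" for q r
    proof -
      have "norm (moment T (h q) w r) \<le> 2 * K1 * exp (C2 * m) * exp (X * T) * (1 + T) ^ d * T"
        using h_cont h_le T pos Rew X that by (intro moment_norm_le) auto
      also have "\<dots> = (2 * K1 * exp (X * T) * (1 + T) ^ d * T) * exp (C2 * m)" by (simp add: mult_ac)
      also have "\<dots> \<le> K2 * exp (C4 * m)"
        using pos C m by (intro mult_mono) (auto simp: C4_def)
      finally show ?thesis by (simp add: B_def)
    qed
    have h_zero: "moment T (h q) v r = 0" if q: "q < d" and van: "vanishes_to_order R v e" and "r < e" for q v r e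
    proof -
      obtain H where H: "H holomorphic_on UNIV" "\<And>z. R z = (z - v) ^ e * H z"
        using van by (auto simp: vanishes_to_order_def)
      show ?thesis
      proof (rule moment_eq_0)
        show "(\<lambda>z. (z - w) ^ q * H z * \<Psi> z) holomorphic_on UNIV" by (intro holomorphic_intros H \<Psi>_hol)
        show "integral {0..T} (\<lambda>x. exp (z * of_real x) * h q x) = (z - v) ^ e * ((z - w) ^ q * H z * \<Psi> z)" for z
          unfolding h_int[OF q] H(2) by (simp only: mult_ac)
      qed (use h_cont q \<open>r < e\<close> in auto)
    qed
    have "B \<ge> 1" unfolding B_def using mult_mono[of 1 K2 1 "exp (C4 * m)"] pos m by simp
    then have "\<exists>g. \<forall>q<d. continuous_on {0..T} (g q) \<and>
     (\<forall>x\<in>{0..T}. norm (g q x) \<le> ((1 + real d) * B\<^sup>2) ^ d) \<and>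
     (\<forall>r<d. moment T (g q) w r = (if q = r then 1 else 0)) \<and>
     (\<forall>v r. (\<forall>q<d. moment T (h q) v r = 0) \<longrightarrow> moment T (g q) v r = 0)" (is "\<exists>g. ?P g")
      using h_cont h_B h_diag h_upper moment_eq_0[OF h_cont RPsi h_int]
      by (intro triangular_biorthogonalization) auto
    then obtain g where g: "?P g" ..
    have B_D: "((1 + real d) * B\<^sup>2) ^ d \<le> D * exp (D * m)"
    proof -
      have "((1 + real d) * B\<^sup>2) ^ d = ((1 + real d) * K2\<^sup>2) ^ d * exp (2 * real d * C4 * m)"
      proof -
        have "B\<^sup>2 = K2\<^sup>2 * exp (2 * (C4 * m))"
          unfolding B_def power_mult_distrib by (simp only: exp_double)
        then have "((1 + real d) * B\<^sup>2) ^ d = (((1 + real d) * K2\<^sup>2) * exp (2 * (C4 * m))) ^ d"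
          by (simp only: mult.assoc)
        also have "\<dots> = ((1 + real d) * K2\<^sup>2) ^ d * exp (real d * (2 * (C4 * m)))"
          by (simp only: power_mult_distrib exp_of_nat_mult)
        also have "real d * (2 * (C4 * m)) = 2 * real d * C4 * m" by simp
        finally show ?thesis .
      qed
      also have "\<dots> \<le> D * exp (D * m)"
        using pos m by (intro mult_mono) (auto simp: D_def algebra_simps)
      finally show ?thesis .
    qed
    show "\<exists>g. \<forall>q<d. continuous_on {0..T} (g q) \<and>
            (\<forall>x\<in>{0..T}. norm (g q x) \<le> D * exp (D * m)) \<and>
            (\<forall>r<d. moment T (g q) w r = (if q = r then 1 else 0)) \<and>
            (\<forall>v r e. vanishes_to_order R v e \<longrightarrow> r < e \<longrightarrow> moment T (g q) v r = 0)"
    proof (intro exI[of _ g] allI impI conjI ballI)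
      fix q assume q: "q < d"
      note gq = g[rule_format, OF q]
      show "continuous_on {0..T} (g q)" using gq by blast
      show "norm (g q x) \<le> D * exp (D * m)" if "x \<in> {0..T}" for x
        using gq that B_D order.trans by blast
      show "moment T (g q) w r = (if q = r then 1 else 0)" if "r < d" for r
        using gq that by blast
      show "moment T (g q) v r = 0" if "vanishes_to_order R v e" "r < e" for v r e
        using gq h_zero that by blast
    qed
  qed
qed

section \<open>Products majorised by a sine product\<close>

text \<open>
  Expanding a product of factors \<open>1 + u\<close> and omitting the constant term, all the remaining terms
  are dominated by those for \<open>1 + |u|\<close>.
\<close>

lemma norm_prod_minus_one_le:
  fixes x :: "'a \<Rightarrow> 'b :: {real_normed_div_algebra, comm_ring_1}"
  assumes "finite I" "\<And>i. i \<in> I \<Longrightarrow> norm (x i - 1) \<le> y i - 1"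
  shows "norm ((\<Prod>i\<in>I. x i) - 1) \<le> (\<Prod>i\<in>I. y i) - 1"
  using assms
proof (induction I rule: finite_induct)
  case (insert i I)
  have y: "y i \<ge> 1" using order.trans[OF norm_ge_zero insert.prems[of i]] by simp
  have IH: "norm ((\<Prod>i\<in>I. x i) - 1) \<le> (\<Prod>i\<in>I. y i) - 1" using insert by simp
  have "norm (x i) \<le> y i"
    using norm_triangle_ineq[of "x i - 1" 1] insert.prems[of i] by simp
  then have le: "norm (x i * ((\<Prod>i\<in>I. x i) - 1)) \<le> y i * ((\<Prod>i\<in>I. y i) - 1)"
    unfolding norm_mult using IH y by (intro mult_mono) auto
  have eq: "(\<Prod>i\<in>insert i I. x i) - 1 = x i * ((\<Prod>i\<in>I. x i) - 1) + (x i - 1)"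
    using insert by (simp add: algebra_simps)
  have "norm ((\<Prod>i\<in>insert i I. x i) - 1) \<le> y i * ((\<Prod>i\<in>I. y i) - 1) + (y i - 1)"
    unfolding eq by (rule order.trans[OF norm_triangle_ineq add_mono[OF le insert.prems]]) simp
  then show ?case using insert by (simp add: algebra_simps)
qed simp

text \<open>
  The product formula for the sine at \<open>\<i> y\<close>, with \<open>y^2 \<ge> s\<close>, has increasing partial products.
  Taking \<open>y \<ge> 1\<close> absorbs the factor \<open>\<pi> y\<close> in that formula.
\<close>

lemma prod_one_plus_over_square_le:
  fixes s :: real
  assumes "s \<ge> 0"
  shows "(\<Prod>i<n. 1 + s / (real (Suc i))\<^sup>2) \<le> exp (pi * (1 + sqrt s))"
proof -
  \<comment> \<open>the maximum covers \<open>s < 1\<close>, where the factor \<open>\<pi> y\<close> of the sine could be small\<close>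
  define y where "y = max 1 (sqrt s)"
  have y: "y \<ge> 1" "y \<le> 1 + sqrt s" "s \<le> y\<^sup>2"
    using assms power_mono[of "sqrt s" y 2] by (auto simp: y_def)
  define F where "F n = (\<Prod>k=1..n. 1 + y\<^sup>2 / (real k)\<^sup>2)" for n
  have F_ge: "F n \<ge> 1" for n unfolding F_def by (intro prod_ge_1) auto
  have "incseq F"
  proof (rule incseq_SucI)
    fix n
    have "F n * 1 \<le> F n * (1 + y\<^sup>2 / (real (Suc n))\<^sup>2)"
      using F_ge[of n] by (intro mult_left_mono) auto
    then show "F n \<le> F (Suc n)" by (simp add: F_def)
  qed
  have "(\<lambda>n. norm (of_real pi * (\<i> * of_real y) * (\<Prod>k=1..n. 1 - (\<i> * of_real y)\<^sup>2 / (of_nat k)\<^sup>2)))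
      \<longlonglongrightarrow> norm (sin (of_real pi * (\<i> * of_real y)))"
    by (rule tendsto_norm[OF sin_product_formula_complex[of "\<i> * of_real y"]])
  also have "(\<lambda>n. norm (of_real pi * (\<i> * of_real y) * (\<Prod>k=1..n. 1 - (\<i> * of_real y)\<^sup>2 / (of_nat k)\<^sup>2)))
      = (\<lambda>n. pi * y * F n)"
  proof
    fix n
    have "(\<Prod>k=1..n. 1 - (\<i> * of_real y)\<^sup>2 / (of_nat k)\<^sup>2) = complex_of_real (F n)"
      by (simp add: F_def power_mult_distrib)
    then show "norm (of_real pi * (\<i> * of_real y) * (\<Prod>k=1..n. 1 - (\<i> * of_real y)\<^sup>2 / (of_nat k)\<^sup>2)) = pi * y * F n"
      using F_ge[of n] y by (simp add: norm_mult)
  qed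
  finally have lim: "(\<lambda>n. pi * y * F n) \<longlonglongrightarrow> norm (sin (of_real pi * (\<i> * of_real y)))" .
  have "incseq (\<lambda>n. pi * y * F n)"
    using \<open>incseq F\<close> y by (auto simp: incseq_def intro!: mult_left_mono)
  then have "pi * y * F n \<le> norm (sin (of_real pi * (\<i> * of_real y)))"
    by (rule incseq_le[OF _ lim])
  also have "\<dots> \<le> exp (pi * y)"
  proof -
    have "norm (exp (\<i> * (of_real pi * (\<i> * of_real y))) - exp (- (\<i> * (of_real pi * (\<i> * of_real y))))) \<le> exp (- (pi * y)) + exp (pi * y)"
      by (rule order.trans[OF norm_triangle_ineq4]) (simp add: norm_exp_eq_Re)
    moreover have "exp (- (pi * y)) \<le> exp (pi * y)" using y by simp
    ultimately have "norm (exp (\<i> * (of_real pi * (\<i> * of_real y))) - exp (- (\<i> * (of_real pi * (\<i> * of_real y))))) \<le> 2 * exp (pi * y)"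
      by linarith
    then show ?thesis by (simp add: sin_exp_eq norm_divide norm_mult)
  qed
  finally have "pi * y * F n \<le> exp (pi * y)" .
  moreover have "1 * 1 * F n \<le> pi * y * F n"
    using y F_ge[of n] pi_gt3 by (intro mult_right_mono mult_mono) auto
  ultimately have "F n \<le> exp (pi * y)" by simp
  also have "\<dots> \<le> exp (pi * (1 + sqrt s))" using y by simp
  finally have "F n \<le> exp (pi * (1 + sqrt s))" .
  moreover have "(\<Prod>i<n. 1 + s / (real (Suc i))\<^sup>2) \<le> (\<Prod>i<n. 1 + y\<^sup>2 / (real (Suc i))\<^sup>2)"
    using y assms by (intro prod_mono) (auto intro!: divide_right_mono add_nonneg_nonneg)
  moreover have "\<dots> = F n" unfolding F_def
    by (rule prod.reindex_bij_witness[of _ "\<lambda>k. k - 1" Suc]) auto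
  ultimately show ?thesis by simp
qed

text \<open>
  The index \<open>i\<close> stands for the level \<open>Suc i\<close>. The majorant is a power of a factor of the product
  for the hyperbolic sine, so that it yields both convergence and the growth
  \<open>exp (C sqrt |z|)\<close>.
\<close>

definition majorised :: "real \<Rightarrow> nat \<Rightarrow> (nat \<Rightarrow> complex \<Rightarrow> complex) \<Rightarrow> bool" where
  "majorised \<Gamma> N a \<longleftrightarrow> \<Gamma> \<ge> 0 \<and> (\<forall>i. a i holomorphic_on UNIV) \<and>
     (\<forall>i z. norm (a i z - 1) \<le> (1 + (norm z + \<Gamma>) / (real (Suc i))\<^sup>2) ^ N - 1)"

lemma majorised_shift:
  assumes "majorised \<Gamma> N a"
  shows "majorised \<Gamma> N (\<lambda>i. a (i + k))"
  unfolding majorised_def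
proof (intro conjI allI)
  fix i z
  have \<Gamma>: "\<Gamma> \<ge> 0" using assms by (simp add: majorised_def)
  have "norm (a (i + k) z - 1) \<le> (1 + (norm z + \<Gamma>) / (real (Suc (i + k)))\<^sup>2) ^ N - 1"
    using assms unfolding majorised_def by blast
  also have "\<dots> \<le> (1 + (norm z + \<Gamma>) / (real (Suc i))\<^sup>2) ^ N - 1"
    using \<Gamma> by (intro diff_mono power_mono add_mono divide_left_mono power_mono) auto
  finally show "norm (a (i + k) z - 1) \<le> (1 + (norm z + \<Gamma>) / (real (Suc i))\<^sup>2) ^ N - 1" .
next
  show "\<Gamma> \<ge> 0" "a (i + k) holomorphic_on UNIV" for i
    using assms unfolding majorised_def by blast+
qed

lemma majorised_le_summable:
  assumes a: "majorised \<Gamma> N a" and z: "norm z \<le> r"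
  shows "norm (a i z - 1) \<le> real N * (r + \<Gamma>) * exp (real N * (r + \<Gamma>)) * (1 / (real (Suc i))\<^sup>2)"
proof -
  define t where "t = real N * ((r + \<Gamma>) / (real (Suc i))\<^sup>2)"
  define u where "u = real N * (r + \<Gamma>)"
  have \<Gamma>: "\<Gamma> \<ge> 0" using a by (simp add: majorised_def)
  have r: "r \<ge> 0" using order.trans[OF norm_ge_zero z] .
  have sq: "1 \<le> (real (Suc i))\<^sup>2" by (intro one_le_power) simp
  have u: "u \<ge> 0" "t \<ge> 0" "t \<le> u" "t = u * (1 / (real (Suc i))\<^sup>2)"
    using \<Gamma> r sq mult_left_mono[OF sq, of "real N * (r + \<Gamma>)"] by (auto simp: u_def t_def field_simps)
  have "norm (a i z - 1) \<le> (1 + (norm z + \<Gamma>) / (real (Suc i))\<^sup>2) ^ N - 1"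
    using a unfolding majorised_def by blast
  also have "\<dots> \<le> (exp ((r + \<Gamma>) / (real (Suc i))\<^sup>2)) ^ N - 1"
  proof (intro diff_mono power_mono)
    have "1 + (norm z + \<Gamma>) / (real (Suc i))\<^sup>2 \<le> 1 + (r + \<Gamma>) / (real (Suc i))\<^sup>2"
      using z by (intro add_mono divide_right_mono) auto
    then show "1 + (norm z + \<Gamma>) / (real (Suc i))\<^sup>2 \<le> exp ((r + \<Gamma>) / (real (Suc i))\<^sup>2)"
      using exp_ge_add_one_self order.trans by blast
  qed (use \<Gamma> in auto)
  also have "\<dots> = exp t - 1" by (simp only: t_def exp_of_nat_mult)
  also have "\<dots> \<le> t * exp t"
  proof -
    have "1 - t \<le> exp (- t)" using exp_ge_add_one_self[of "- t"] by simp
    then have "(1 - t) * exp t \<le> exp (- t) * exp t" by (intro mult_right_mono) auto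
    then show ?thesis by (simp add: algebra_simps flip: exp_add)
  qed
  also have "\<dots> \<le> t * exp u" using u by (intro mult_left_mono) auto
  finally have "norm (a i z - 1) \<le> u * (1 / (real (Suc i))\<^sup>2) * exp u" unfolding u(4) .
  then show ?thesis by (simp add: u_def mult_ac)
qed

lemma summable_inverse_Suc_squares: "summable (\<lambda>i. 1 / (real (Suc i))\<^sup>2)"
  using summable_Suc_iff[of "\<lambda>i. inverse ((real i)\<^sup>2)"] inverse_power_summable[of 2, where 'a = real]
  by (simp add: inverse_eq_divide)

lemma majorised_convergent_prod:
  assumes a: "majorised \<Gamma> N a"
  shows "convergent_prod (\<lambda>i. a i z)"
proof -
  have "summable (\<lambda>i. norm (a i z - 1))"
  proof (rule summable_comparison_test'[OF summable_mult[OF summable_inverse_Suc_squares], of 0])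
    show "norm (norm (a i z - 1)) \<le> real N * (norm z + \<Gamma>) * exp (real N * (norm z + \<Gamma>)) * (1 / (real (Suc i))\<^sup>2)" for i
      unfolding real_norm_def abs_norm_cancel by (rule majorised_le_summable[OF a order.refl])
  qed
  then show ?thesis
    by (intro abs_convergent_prod_imp_convergent_prod summable_imp_abs_convergent_prod)
qed

lemma majorised_prodinf_tendsto:
  assumes a: "majorised \<Gamma> N a"
  shows "(\<lambda>n. \<Prod>i<n. a i z) \<longlonglongrightarrow> (\<Prod>i. a i z)"
  using convergent_prod_LIMSEQ[OF majorised_convergent_prod[OF a, of z]]
  unfolding lessThan_Suc_atMost[symmetric] by (rule LIMSEQ_imp_Suc[of "\<lambda>n. \<Prod>i<n. a i z"])

lemma majorised_prodinf_split:
  assumes a: "majorised \<Gamma> N a"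
  shows "(\<Prod>i. a i z) = (\<Prod>i<k. a i z) * (\<Prod>i. a (i + k) z)"
  using has_prod_unique[OF has_prod_ignore_initial_segment'[OF majorised_convergent_prod[OF a, of z], of k]]
  by (rule sym)

lemma majorised_prodinf_holomorphic:
  assumes a: "majorised \<Gamma> N a"
  shows "(\<lambda>z. \<Prod>i. a i z) holomorphic_on UNIV"
proof (rule holomorphic_uniform_sequence[OF open_UNIV])
  have hol: "a i holomorphic_on UNIV" for i using a by (simp add: majorised_def)
  then show "(\<lambda>z. \<Prod>i<n. a i z) holomorphic_on UNIV" for n by (intro holomorphic_intros) auto
  fix x :: complex
  have "uniformly_convergent_on (cball x 1) (\<lambda>n z. \<Prod>i<n. a i z)"
  proof (rule uniformly_convergent_on_prod')
    show "continuous_on (cball x 1) (a i)" for i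
      using holomorphic_on_imp_continuous_on[OF hol] continuous_on_subset by blast
    show "uniformly_convergent_on (cball x 1) (\<lambda>n z. \<Sum>i<n. norm (a i z - 1))"
    proof (rule Weierstrass_m_test'[OF _ summable_mult[OF summable_inverse_Suc_squares]])
      fix i z assume "z \<in> cball x 1"
      then have "norm z \<le> norm x + 1" using norm_triangle_sub[of z x] by (simp add: dist_norm norm_minus_commute)
      from majorised_le_summable[OF a this, of i]
      show "norm (norm (a i z - 1)) \<le> real N * ((norm x + 1) + \<Gamma>) * exp (real N * ((norm x + 1) + \<Gamma>)) * (1 / (real (Suc i))\<^sup>2)"
        by simp
    qed
  qed simp
  then obtain l where l: "uniform_limit (cball x 1) (\<lambda>n z. \<Prod>i<n. a i z) l sequentially"
    by (auto simp: uniformly_convergent_on_def)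
  have "l z = (\<Prod>i. a i z)" if "z \<in> cball x 1" for z
    using tendsto_uniform_limitI[OF l that] majorised_prodinf_tendsto[OF a, of z] by (rule LIMSEQ_unique)
  then have "uniform_limit (cball x 1) (\<lambda>n z. \<Prod>i<n. a i z) l sequentially
      \<longleftrightarrow> uniform_limit (cball x 1) (\<lambda>n z. \<Prod>i<n. a i z) (\<lambda>z. \<Prod>i. a i z) sequentially"
    by (intro uniform_limit_cong' refl)
  with l have "uniform_limit (cball x 1) (\<lambda>n z. \<Prod>i<n. a i z) (\<lambda>z. \<Prod>i. a i z) sequentially"
    by (rule iffD1[rotated])
  then show "\<exists>d>0. cball x d \<subseteq> UNIV \<and> uniform_limit (cball x d) (\<lambda>n z. \<Prod>i<n. a i z) (\<lambda>z. \<Prod>i. a i z) sequentially"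
    by (intro exI[of _ 1]) auto
qed

lemma majorised_prodinf_norm_le:
  assumes a: "majorised \<Gamma> N a"
  shows "norm (\<Prod>i. a i z) \<le> exp (real N * pi * (1 + sqrt (norm z + \<Gamma>)))"
proof (rule LIMSEQ_le_const2[OF tendsto_norm[OF majorised_prodinf_tendsto[OF a, of z]]])
  have \<Gamma>: "\<Gamma> \<ge> 0" using a by (simp add: majorised_def)
  have "norm (\<Prod>i<n. a i z) \<le> exp (real N * pi * (1 + sqrt (norm z + \<Gamma>)))" for n
  proof -
    let ?P = "\<Prod>i<n. 1 + (norm z + \<Gamma>) / (real (Suc i))\<^sup>2"
    have "norm (a i z) \<le> (1 + (norm z + \<Gamma>) / (real (Suc i))\<^sup>2) ^ N" for i
      using a norm_triangle_ineq[of "a i z - 1" 1] unfolding majorised_def by (smt (verit) diff_add_cancel norm_one)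
    then have "norm (\<Prod>i<n. a i z) \<le> (\<Prod>i<n. (1 + (norm z + \<Gamma>) / (real (Suc i))\<^sup>2) ^ N)"
      unfolding prod_norm[symmetric] by (intro prod_mono) auto
    also have "\<dots> = ?P ^ N" by (rule prod_power_distrib[symmetric])
    also have "\<dots> \<le> exp (pi * (1 + sqrt (norm z + \<Gamma>))) ^ N"
      using \<Gamma> by (intro power_mono prod_one_plus_over_square_le prod_nonneg) auto
    finally show ?thesis by (simp add: mult.assoc flip: exp_of_nat_mult)
  qed
  then show "\<exists>n0. \<forall>n\<ge>n0. norm (\<Prod>i<n. a i z) \<le> exp (real N * pi * (1 + sqrt (norm z + \<Gamma>)))" by blast
qed

lemma norm_power_minus_one_le:
  fixes x :: complex
  assumes "norm (x - 1) \<le> y - 1"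
  shows "norm (x ^ n - 1) \<le> y ^ n - 1"
  using norm_prod_minus_one_le[of "{..<n}" "\<lambda>_. x" "\<lambda>_. y"] assms by simp

section \<open>Size and separation of the temporal roots\<close>

text \<open>
  Working with this polynomial instead of its roots avoids the complex square root and treats simple
  and double roots alike.
\<close>

definition temporal_poly :: "real \<Rightarrow> complex \<Rightarrow> nat \<Rightarrow> complex \<Rightarrow> complex" where
  "temporal_poly \<rho> c n z = z ^ 2 + of_real \<rho> * of_nat n ^ 2 * z + of_nat n ^ 4 + c"

lemma temporal_roots_sum: "temporal_root \<rho> c n Plus + temporal_root \<rho> c n Minus = - of_real \<rho> * of_nat n ^ 2"
  by (simp add: add_divide_distrib[symmetric])

lemma temporal_poly_factor:
  "temporal_poly \<rho> c n z = (z - temporal_root \<rho> c n Plus) * (z - temporal_root \<rho> c n Minus)"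
proof -
  define p q where "p = temporal_root \<rho> c n Plus" and "q = temporal_root \<rho> c n Minus"
  have "temporal_poly \<rho> c n p = 0"
    using temporal_root_iff[of p \<rho> n c] by (simp add: temporal_poly_def p_def)
  then have "temporal_poly \<rho> c n z = temporal_poly \<rho> c n z - temporal_poly \<rho> c n p" by simp
  also have "\<dots> = (z - p) * (z + p + of_real \<rho> * of_nat n ^ 2)"
    by (simp add: temporal_poly_def algebra_simps power2_eq_square)
  also have "of_real \<rho> * of_nat n ^ 2 = - p - q"
    using temporal_roots_sum[of \<rho> c n] by (simp add: p_def q_def algebra_simps eq_neg_iff_add_eq_0)
  finally show ?thesis by (simp add: p_def q_def)
qed

text \<open>
  Subtract the equation of \<open>w\<close>: the quadratic terms cancel, and \<open>n^2 - m^2\<close> splits off.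
\<close>

lemma temporal_poly_difference:
  assumes "temporal_poly \<rho> c m w = 0"
  shows "temporal_poly \<rho> c' n w
     = (of_nat n ^ 2 - of_nat m ^ 2) * (of_real \<rho> * w + of_nat n ^ 2 + of_nat m ^ 2) + (c' - c)"
proof -
  have "temporal_poly \<rho> c' n w = temporal_poly \<rho> c' n w - temporal_poly \<rho> c m w" using assms by simp
  also have "\<dots> = (of_nat n ^ 2 - of_nat m ^ 2) * (of_real \<rho> * w + of_nat n ^ 2 + of_nat m ^ 2) + (c' - c)"
    by (simp add: temporal_poly_def algebra_simps power2_eq_square power4_eq_xxxx)
  finally show ?thesis .
qed

lemma temporal_poly_normalised:
  assumes "0 < \<rho>" "\<rho> < 2" "norm c \<le> \<Gamma>" "n \<ge> 1"
  shows "norm (temporal_poly \<rho> c n z / of_nat n ^ 4 - 1) \<le> (1 + (norm z + \<Gamma>) / (real n)\<^sup>2)\<^sup>2 - 1"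
proof -
  define M where "M = (real n)\<^sup>2"
  have M: "M \<ge> 1" using assms by (simp add: M_def)
  have n4: "(of_nat n ^ 4 :: complex) \<noteq> 0" "norm (of_nat n ^ 4 :: complex) = M\<^sup>2"
    using assms by (auto simp: M_def norm_power)
  have \<Gamma>: "\<Gamma> \<ge> 0" using assms norm_ge_zero order.trans by blast
  have "temporal_poly \<rho> c n z / of_nat n ^ 4 - 1 = (z ^ 2 + of_real \<rho> * of_nat n ^ 2 * z + c) / of_nat n ^ 4"
    using n4 by (simp add: temporal_poly_def field_simps)
  then have "norm (temporal_poly \<rho> c n z / of_nat n ^ 4 - 1) = norm (z ^ 2 + of_real \<rho> * of_nat n ^ 2 * z + c) / M\<^sup>2"
    by (simp only: norm_divide n4)
  also have "\<dots> \<le> ((norm z + \<Gamma>)\<^sup>2 + 2 * M * (norm z + \<Gamma>)) / M\<^sup>2"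
  proof (intro divide_right_mono)
    have "norm (of_real \<rho> * of_nat n ^ 2 * z) = \<rho> * (M * norm z)"
      using assms by (simp add: norm_mult norm_power M_def)
    also have "\<dots> \<le> 2 * (M * norm z)" using assms M by (intro mult_right_mono) auto
    finally have "norm (z ^ 2 + of_real \<rho> * of_nat n ^ 2 * z + c) \<le> (norm z)\<^sup>2 + 2 * M * norm z + \<Gamma>"
      using assms(3) norm_triangle_ineq[of "z ^ 2 + of_real \<rho> * of_nat n ^ 2 * z" c]
        norm_triangle_ineq[of "z ^ 2" "of_real \<rho> * of_nat n ^ 2 * z"]
      by (simp add: norm_power)
    moreover have "(norm z)\<^sup>2 \<le> (norm z + \<Gamma>)\<^sup>2" using \<Gamma> by (intro power_mono) auto
    moreover have "\<Gamma> \<le> 2 * M * \<Gamma>" using mult_right_mono[of 1 "2 * M" \<Gamma>] M \<Gamma> by simp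
    ultimately show "norm (z ^ 2 + of_real \<rho> * of_nat n ^ 2 * z + c) \<le> (norm z + \<Gamma>)\<^sup>2 + 2 * M * (norm z + \<Gamma>)"
      unfolding distrib_left by linarith
  qed auto
  also have "\<dots> = (1 + (norm z + \<Gamma>) / M)\<^sup>2 - 1"
    using M by (simp add: field_simps power2_eq_square)
  finally show ?thesis by (simp add: M_def)
qed

lemma root_norm_le:
  assumes "0 < \<rho>" "\<rho> < 2" "norm c \<le> \<Gamma>" "m \<ge> 1" and root: "temporal_poly \<rho> c m w = 0"
  shows "norm w \<le> (3 + \<Gamma>) * (real m)\<^sup>2"
proof (rule ccontr)
  define M where "M = (real m)\<^sup>2"
  have M: "M \<ge> 1" using assms by (simp add: M_def)
  have \<Gamma>: "\<Gamma> \<ge> 0" using assms norm_ge_zero order.trans by blast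
  assume "\<not> ?thesis"
  then have big: "norm w > (3 + \<Gamma>) * M" by (simp add: M_def)
  have "w ^ 2 = - (of_real \<rho> * of_nat m ^ 2 * w) - of_nat m ^ 4 - c"
    using root unfolding temporal_poly_def by (simp add: algebra_simps eq_neg_iff_add_eq_0)
  then have "norm (w ^ 2) = norm (of_real \<rho> * of_nat m ^ 2 * w + of_nat m ^ 4 + c)"
    by (metis diff_minus_eq_add minus_add_distrib norm_minus_cancel minus_diff_eq add.commute diff_conv_add_uminus)
  also have "\<dots> \<le> norm (of_real \<rho> * of_nat m ^ 2 * w) + norm (of_nat m ^ 4 :: complex) + norm c"
    by (intro order.trans[OF norm_triangle_ineq] add_mono norm_triangle_ineq order.refl)
  also have "norm (of_real \<rho> * of_nat m ^ 2 * w) = \<rho> * (M * norm w)"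
    using assms by (simp add: norm_mult norm_power M_def)
  also have "norm (of_nat m ^ 4 :: complex) = M * M"
    by (simp add: norm_power M_def flip: power_add)
  also have "\<rho> * (M * norm w) \<le> 2 * (M * norm w)" using assms M by (intro mult_right_mono) auto
  finally have 1: "norm w * norm w \<le> 2 * (M * norm w) + M * M + \<Gamma>"
    using assms(3) by (simp add: power2_eq_square norm_mult)
  have "(3 + \<Gamma>) * M * norm w \<le> norm w * norm w" using big by (intro mult_right_mono) auto
  moreover have "M * ((3 + \<Gamma>) * M) \<le> M * norm w" using big M by (intro mult_left_mono) auto
  moreover have "\<Gamma> * M * ((3 + \<Gamma>) * M) \<le> \<Gamma> * M * norm w" using big M \<Gamma> by (intro mult_left_mono) auto
  moreover have "M * M \<ge> 1" using M mult_mono[of 1 M 1 M] by simp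
  moreover have "\<Gamma> * 1 \<le> \<Gamma> * (M * M)" using \<Gamma> \<open>M * M \<ge> 1\<close> by (intro mult_left_mono) auto
  moreover have "\<Gamma> * M * ((3 + \<Gamma>) * M) \<ge> 0" using \<Gamma> M by simp
  ultimately show False using 1 by (simp add: algebra_simps)
qed

text \<open>
  Real and imaginary part of \<open>(w + \<rho> m^2 / 2)^2 = -(1 - \<rho>^2/4) m^4 - c\<close>.
\<close>

lemma root_Re_Im:
  assumes root: "temporal_poly \<rho> c m w = 0"
  defines "a \<equiv> Re w + \<rho> * (real m)\<^sup>2 / 2"
  shows "a\<^sup>2 - (Im w)\<^sup>2 = - ((1 - \<rho>\<^sup>2 / 4) * ((real m)\<^sup>2)\<^sup>2) - Re c" "2 * a * Im w = - Im c"
proof -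
  have n: "of_nat m ^ 2 = complex_of_real ((real m)\<^sup>2)" "of_nat m ^ 4 = complex_of_real (((real m)\<^sup>2)\<^sup>2)"
    by simp_all
  have "Re (temporal_poly \<rho> c m w) = 0" "Im (temporal_poly \<rho> c m w) = 0" using root by simp_all
  then show "a\<^sup>2 - (Im w)\<^sup>2 = - ((1 - \<rho>\<^sup>2 / 4) * ((real m)\<^sup>2)\<^sup>2) - Re c" "2 * a * Im w = - Im c"
    unfolding temporal_poly_def n a_def
    by (simp_all add: power2_eq_square field_simps)
qed

text \<open>
  A large real part \<open>a\<close> of \<open>w + \<rho> m^2 / 2\<close> would force, through \<open>2 a Im w = -Im c\<close>, a small imaginary
  part, which contradicts \<open>a^2 - (Im w)^2 \<le> \<Gamma>\<close>.
\<close>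

lemma root_Re_le:
  assumes "0 < \<rho>" "\<rho> < 2" "norm c \<le> \<Gamma>" and root: "temporal_poly \<rho> c m w = 0"
  shows "Re w \<le> 1 + \<Gamma>"
proof (rule ccontr)
  define a where "a = Re w + \<rho> * (real m)\<^sup>2 / 2"
  note ab = root_Re_Im[OF root, folded a_def]
  have \<Gamma>: "\<Gamma> \<ge> 0" using assms norm_ge_zero order.trans by blast
  assume "\<not> ?thesis"
  then have a: "a > 1 + \<Gamma>" using assms unfolding a_def by (smt (verit) divide_nonneg_nonneg mult_nonneg_nonneg zero_le_power2)
  have "1 * \<bar>Im w\<bar> \<le> a * \<bar>Im w\<bar>" using a \<Gamma> by (intro mult_right_mono) auto
  also have "a * \<bar>Im w\<bar> = \<bar>Im c\<bar> / 2"
    using ab(2) a \<Gamma> abs_mult[of a "Im w"] by simp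
  also have "\<dots> \<le> \<Gamma>" using abs_Im_le_cmod[of c] assms by simp
  finally have "(Im w)\<^sup>2 \<le> \<Gamma>\<^sup>2" by (simp add: abs_le_square_iff[symmetric] \<Gamma>)
  moreover have "\<rho>\<^sup>2 \<le> 2\<^sup>2" using assms by (intro power_mono) auto
  then have "(1 - \<rho>\<^sup>2 / 4) * ((real m)\<^sup>2)\<^sup>2 \<ge> 0" by simp
  moreover have "- Re c \<le> \<Gamma>" using abs_Re_le_cmod[of c] assms by simp
  ultimately have "a\<^sup>2 \<le> \<Gamma>\<^sup>2 + \<Gamma>" using ab(1) by linarith
  moreover have "(1 + \<Gamma>)\<^sup>2 \<le> a\<^sup>2" using a \<Gamma> by (intro power_mono) auto
  ultimately show False using \<Gamma> by (simp add: power2_eq_square algebra_simps)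
qed

text \<open>
  This is where \<open>\<rho> < 2\<close> enters: from some level on, the roots are not real, and their distance to
  the real axis is of order \<open>m^2\<close>.
\<close>

lemma root_Im_ge:
  assumes "0 < \<rho>" "\<rho> < 2" "norm c \<le> \<Gamma>" and root: "temporal_poly \<rho> c m w = 0"
    and m: "\<Gamma> \<le> (1 - \<rho>\<^sup>2 / 4) / 2 * (real m)\<^sup>2" "m \<ge> 1"
  shows "\<bar>Im w\<bar> \<ge> sqrt ((1 - \<rho>\<^sup>2 / 4) / 2) * (real m)\<^sup>2"
proof -
  define \<delta> where "\<delta> = 1 - \<rho>\<^sup>2 / 4"
  define M where "M = (real m)\<^sup>2"
  define a where "a = Re w + \<rho> * (real m)\<^sup>2 / 2"
  note ab = root_Re_Im[OF root, folded a_def, folded \<delta>_def M_def]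
  have "\<rho>\<^sup>2 < 2\<^sup>2" using assms by (intro power_strict_mono) auto
  then have \<delta>: "\<delta> > 0" by (simp add: \<delta>_def)
  have M: "M \<ge> 1" using m by (simp add: M_def)
  have "\<Gamma> \<le> \<delta> / 2 * (M * 1)" using m by (simp add: \<delta>_def M_def)
  also have "\<dots> \<le> \<delta> / 2 * (M * M)" using \<delta> M by (intro mult_left_mono) auto
  finally have "\<Gamma> \<le> \<delta> / 2 * M\<^sup>2" by (simp add: power2_eq_square)
  moreover have "- Re c \<le> \<Gamma>" using abs_Re_le_cmod[of c] assms by simp
  moreover have "a\<^sup>2 \<ge> 0" by simp
  ultimately have "\<delta> / 2 * M\<^sup>2 \<le> (Im w)\<^sup>2" using ab(1) by linarith
  then have "sqrt (\<delta> / 2 * M\<^sup>2) \<le> sqrt ((Im w)\<^sup>2)" by (rule real_sqrt_le_mono)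
  moreover have "sqrt (\<delta> / 2 * M\<^sup>2) = sqrt (\<delta> / 2) * M"
    unfolding real_sqrt_mult real_sqrt_abs using M by simp
  ultimately show ?thesis by (simp only: real_sqrt_abs \<delta>_def M_def)
qed

text \<open>
  The product is \<open>1 / (J choose m)\<close>.
\<close>

lemma prod_distance_ratio_ge:
  assumes "1 \<le> m" "m \<le> J"
  shows "(\<Prod>n\<in>{1..J} - {m}. \<bar>real n - real m\<bar> / real n) \<ge> (1 / 2) ^ J"
proof -
  have split: "{1..J} - {m} = {1..<m} \<union> {m<..J}" using assms by auto
  have "(\<Prod>n\<in>{1..<m}. \<bar>real n - real m\<bar>) = (\<Prod>i=1..m-1. real i)"
    by (rule prod.reindex_bij_witness[of _ "\<lambda>i. m - i" "\<lambda>n. m - n"]) (use assms in auto)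
  then have 1: "(\<Prod>n\<in>{1..<m}. \<bar>real n - real m\<bar>) = fact (m - 1)" by (simp add: fact_prod)
  have "(\<Prod>n\<in>{m<..J}. \<bar>real n - real m\<bar>) = (\<Prod>i=1..J-m. real i)"
    by (rule prod.reindex_bij_witness[of _ "\<lambda>i. m + i" "\<lambda>n. n - m"]) (use assms in auto)
  then have 2: "(\<Prod>n\<in>{m<..J}. \<bar>real n - real m\<bar>) = fact (J - m)" by (simp add: fact_prod)
  have "(\<Prod>n\<in>{1..J}. real n) = real m * (\<Prod>n\<in>{1..J} - {m}. real n)"
    by (rule prod.remove) (use assms in auto)
  then have 3: "fact J = real m * (\<Prod>n\<in>{1..J} - {m}. real n)" by (simp add: fact_prod)
  have m: "fact m = real m * fact (m - 1)" using assms by (simp add: fact_reduce)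
  have "(\<Prod>n\<in>{1..J} - {m}. \<bar>real n - real m\<bar>) = fact (m - 1) * fact (J - m)"
    unfolding split 1[symmetric] 2[symmetric] by (rule prod.union_disjoint) auto
  then have "(\<Prod>n\<in>{1..J} - {m}. \<bar>real n - real m\<bar> / real n)
     = fact (m - 1) * fact (J - m) / (\<Prod>n\<in>{1..J} - {m}. real n)"
    by (simp add: prod_dividef)
  also have "\<dots> = fact m * fact (J - m) / fact J"
    unfolding 3 m using assms by simp
  also have "\<dots> = 1 / real (J choose m)" using assms by (simp add: binomial_fact)
  also have "\<dots> \<ge> 1 / 2 ^ J"
  proof (intro divide_left_mono)
    have "(J choose m) \<le> 2 ^ J"
      using member_le_sum[of m "{..J}" "\<lambda>k. J choose k"] assms by (simp add: choose_row_sum)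
    then have "real (J choose m) \<le> real (2 ^ J)" by (rule of_nat_mono)
    then show "real (J choose m) \<le> 2 ^ J" by simp
  qed (use assms in \<open>auto simp: zero_less_binomial\<close>)
  finally show ?thesis by (simp add: power_one_over)
qed

lemma sum_inverse_squares_le:
  assumes "J \<ge> 1" "J \<le> J'"
  shows "(\<Sum>n\<in>{J<..J'}. 1 / (real n)\<^sup>2) \<le> 1 / real J - 1 / real J'"
  using assms(2)
proof (induction J' rule: dec_induct)
  case (step n)
  have n: "n \<ge> 1" using step assms by simp
  have "{J<..Suc n} = insert (Suc n) {J<..n}" using step by auto
  then have "(\<Sum>n\<in>{J<..Suc n}. 1 / (real n)\<^sup>2) \<le> 1 / (real (Suc n))\<^sup>2 + (1 / real J - 1 / real n)"
    using step by simp
  moreover have "1 / (real (Suc n))\<^sup>2 \<le> 1 / real n - 1 / real (Suc n)"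
  proof -
    have "1 / real n - 1 / real (Suc n) = 1 / (real n * real (Suc n))" using n by (simp add: field_simps)
    moreover have "1 / (real (Suc n))\<^sup>2 \<le> 1 / (real n * real (Suc n))"
      using n by (intro divide_left_mono) (auto simp: power2_eq_square intro!: mult_right_mono)
    ultimately show ?thesis by simp
  qed
  ultimately show ?case by linarith
qed simp

text \<open>
  If \<open>s\<close> is large compared with \<open>w\<close>, the positive numbers \<open>s\<close> and \<open>M\<close> dominate; otherwise the
  imaginary part of \<open>w\<close>, which is of order \<open>M\<close>, is comparable with \<open>s + M\<close>.
\<close>

lemma damped_sum_norm_ge:
  assumes "0 < \<rho>" "\<rho> < 2" "X > 0" "\<kappa> > 0" "M \<ge> 0" "s \<ge> 0"
    and w: "norm w \<le> X * M" "\<bar>Im w\<bar> \<ge> \<kappa> * M"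
  shows "norm (of_real \<rho> * w + of_real s + of_real M) \<ge> min (1 / 2) (\<rho> * \<kappa> / (4 * X)) * (s + M)"
proof (cases "s + M \<ge> 4 * X * M")
  case True
  have "\<rho> * norm w \<le> 2 * (X * M)" using assms by (intro mult_mono) auto
  then have 1: "norm (of_real \<rho> * w) \<le> 2 * X * M" using assms by (simp add: norm_mult)
  have "s + M = norm (of_real s + of_real M :: complex)"
    using assms by (simp flip: of_real_add)
  also have "\<dots> \<le> norm (of_real \<rho> * w + of_real s + of_real M) + norm (of_real \<rho> * w)"
    using norm_triangle_ineq4[of "of_real \<rho> * w + of_real s + of_real M" "of_real \<rho> * w"] by simp
  finally have "1 / 2 * (s + M) \<le> norm (of_real \<rho> * w + of_real s + of_real M)" using 1 True by simp
  moreover have "min (1 / 2) (\<rho> * \<kappa> / (4 * X)) * (s + M) \<le> 1 / 2 * (s + M)"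
    using assms by (intro mult_right_mono) auto
  ultimately show ?thesis by linarith
next
  case False
  have "min (1 / 2) (\<rho> * \<kappa> / (4 * X)) * (s + M) \<le> \<rho> * \<kappa> / (4 * X) * (s + M)"
    using assms by (intro mult_right_mono) auto
  also have "\<dots> \<le> \<rho> * \<kappa> / (4 * X) * (4 * X * M)"
    using assms False by (intro mult_left_mono) auto
  also have "\<dots> = \<rho> * (\<kappa> * M)" using assms by simp
  also have "\<dots> \<le> \<rho> * \<bar>Im w\<bar>" using assms by (intro mult_left_mono) auto
  also have "\<dots> = \<bar>Im (of_real \<rho> * w + of_real s + of_real M)\<bar>" using assms by (simp add: abs_mult)
  also have "\<dots> \<le> norm (of_real \<rho> * w + of_real s + of_real M)" by (rule abs_Im_le_cmod)
  finally show ?thesis .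
qed

text \<open>
  In \<open>(n^2 - m^2) (\<rho> w + n^2 + m^2) + (c' - c)\<close> the product has size at least a multiple of
  \<open>m^2\<close> for \<open>n \<noteq> m\<close>, so that it dominates \<open>c' - c\<close> for large \<open>m\<close>. The powers of \<open>n\<close> in
  \<open>|n - m| (n + m) (n^2 + m^2) \<ge> |n - m| n^3\<close> then account for the division by \<open>n^4\<close>.
\<close>

lemma exists_root_separation:
  assumes \<rho>: "0 < \<rho>" "\<rho> < 2" and \<Gamma>: "\<Gamma> \<ge> 0"
  obtains c1 \<kappa> :: real and m1 :: nat where "0 < c1" "c1 \<le> 1" "0 < \<kappa>" "m1 \<ge> 1"
    "\<And>m c w. m \<ge> m1 \<Longrightarrow> norm c \<le> \<Gamma> \<Longrightarrow> temporal_poly \<rho> c m w = 0 \<Longrightarrow> \<bar>Im w\<bar> \<ge> \<kappa> * (real m)\<^sup>2"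
    "\<And>m n c c' w. m \<ge> m1 \<Longrightarrow> n \<ge> 1 \<Longrightarrow> n \<noteq> m \<Longrightarrow> norm c \<le> \<Gamma> \<Longrightarrow> norm c' \<le> \<Gamma> \<Longrightarrow> temporal_poly \<rho> c m w = 0 \<Longrightarrow>
       norm (temporal_poly \<rho> c' n w / of_nat n ^ 4) \<ge> c1 * (\<bar>real n - real m\<bar> / real n)"
proof -
  define \<delta> where "\<delta> = (1 - \<rho>\<^sup>2 / 4) / 2"
  define \<kappa> where "\<kappa> = sqrt \<delta>"
  define X where "X = 3 + \<Gamma>"
  define \<mu> where "\<mu> = min (1 / 2) (\<rho> * \<kappa> / (4 * X))"
  define c1 where "c1 = \<mu> / 2"
  define m1 where "m1 = Suc (nat \<lceil>max (\<Gamma> / \<delta>) (2 * \<Gamma> / c1)\<rceil>)"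
  have "\<rho>\<^sup>2 < 2\<^sup>2" using \<rho> by (intro power_strict_mono) auto
  then have \<delta>: "\<delta> > 0" by (simp add: \<delta>_def)
  have \<kappa>: "\<kappa> > 0" using \<delta> by (simp add: \<kappa>_def)
  have X: "X > 0" using \<Gamma> by (simp add: X_def)
  have \<mu>: "\<mu> > 0" "\<mu> \<le> 1 / 2" using X \<kappa> \<rho> by (auto simp: \<mu>_def)
  then have c1: "c1 > 0" "c1 \<le> 1" by (auto simp: c1_def)
  have m1: "\<Gamma> \<le> \<delta> * (real m)\<^sup>2" "2 * \<Gamma> \<le> c1 * (real m)\<^sup>2" "m \<ge> 1" if "m \<ge> m1" for m
  proof -
    show "m \<ge> 1" using that by (simp add: m1_def)
    then have "real m \<le> (real m)\<^sup>2" by (simp add: power2_eq_square)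
    moreover have "max (\<Gamma> / \<delta>) (2 * \<Gamma> / c1) \<le> real m"
      using that unfolding m1_def by linarith
    ultimately have "\<Gamma> / \<delta> \<le> (real m)\<^sup>2" "2 * \<Gamma> / c1 \<le> (real m)\<^sup>2" by linarith+
    then show "\<Gamma> \<le> \<delta> * (real m)\<^sup>2" "2 * \<Gamma> \<le> c1 * (real m)\<^sup>2"
      using \<delta> c1 by (simp_all add: field_simps)
  qed
  have im: "\<bar>Im w\<bar> \<ge> \<kappa> * (real m)\<^sup>2" if "m \<ge> m1" "norm c \<le> \<Gamma>" "temporal_poly \<rho> c m w = 0" for m c w
    using root_Im_ge[OF \<rho> that(2,3)] m1[OF that(1)] by (simp add: \<kappa>_def \<delta>_def)
  show thesis
  proof (rule that[OF c1 \<kappa> _ im])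
    show "m1 \<ge> 1" by (simp add: m1_def)
    fix m n :: nat and c c' w :: complex
    assume m: "m \<ge> m1" and n: "n \<ge> 1" "n \<noteq> m" and c: "norm c \<le> \<Gamma>" "norm c' \<le> \<Gamma>" and root: "temporal_poly \<rho> c m w = 0"
    define D where "D = \<bar>real n - real m\<bar>"
    define A where "A = (real n)\<^sup>2 + (real m)\<^sup>2"
    define v where "v = of_real \<rho> * w + of_nat n ^ 2 + of_nat m ^ 2"
    have D: "D \<ge> 1" using n by (auto simp: D_def)
    have "of_nat n ^ 2 - of_nat m ^ 2 = complex_of_real ((real n - real m) * (real n + real m))"
      by (simp add: algebra_simps power2_eq_square)
    then have sq: "norm (of_nat n ^ 2 - of_nat m ^ 2 :: complex) = D * (real n + real m)"
      by (simp only: norm_of_real abs_mult D_def)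
    have v: "norm v \<ge> \<mu> * A"
      using damped_sum_norm_ge[of \<rho> X \<kappa> "(real m)\<^sup>2" "(real n)\<^sup>2" w] root_norm_le[OF \<rho> c(1) m1(3)[OF m] root]
        im[OF m c(1) root] \<rho> X \<kappa> by (simp add: X_def \<mu>_def v_def A_def)
    have A: "A \<ge> (real m)\<^sup>2" "A \<ge> (real n)\<^sup>2" by (auto simp: A_def)
    have Dn: "D * (real n + real m) \<ge> 1" using D n mult_mono[of 1 D 1 "real n + real m"] by simp
    have "2 * \<Gamma> \<le> c1 * (real m)\<^sup>2" by (rule m1[OF m])
    also have "\<dots> \<le> c1 * A" using c1 A by simp
    also have "\<dots> \<le> D * (real n + real m) * (c1 * A)"
      using Dn c1 mult_right_mono[of 1 "D * (real n + real m)" "c1 * A"] by (simp add: A_def)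
    finally have small: "2 * \<Gamma> \<le> D * (real n + real m) * (c1 * A)" .
    have "D * (real n + real m) * (\<mu> * A) \<le> norm ((of_nat n ^ 2 - of_nat m ^ 2) * v)"
      unfolding norm_mult sq using v D by (intro mult_left_mono) auto
    also have "\<dots> \<le> norm ((of_nat n ^ 2 - of_nat m ^ 2) * v + (c' - c)) + norm (c' - c)"
      using norm_triangle_ineq4[of "(of_nat n ^ 2 - of_nat m ^ 2) * v + (c' - c)" "c' - c"] by simp
    also have "(of_nat n ^ 2 - of_nat m ^ 2) * v + (c' - c) = temporal_poly \<rho> c' n w"
      using temporal_poly_difference[OF root] by (simp add: v_def)
    also have "norm (c' - c) \<le> 2 * \<Gamma>" using norm_triangle_ineq4[of c' c] c by simp
    finally have "D * (real n + real m) * (c1 * A) \<le> norm (temporal_poly \<rho> c' n w)"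
      using small by (simp add: c1_def)
    moreover have "D * real n * (c1 * (real n)\<^sup>2) \<le> D * (real n + real m) * (c1 * A)"
      using D c1 A n by (intro mult_mono) auto
    ultimately have "c1 * D * real n ^ 3 \<le> norm (temporal_poly \<rho> c' n w)"
      by (simp add: power2_eq_square power3_eq_cube mult_ac)
    then have "c1 * D * real n ^ 3 / real n ^ 4 \<le> norm (temporal_poly \<rho> c' n w) / real n ^ 4"
      by (intro divide_right_mono) auto
    also have "c1 * D * real n ^ 3 / real n ^ 4 = c1 * (D / real n)"
      using n by (simp add: field_simps power3_eq_cube power4_eq_xxxx)
    finally show "norm (temporal_poly \<rho> c' n w / of_nat n ^ 4) \<ge> c1 * (\<bar>real n - real m\<bar> / real n)"
      by (simp add: norm_divide norm_power D_def)
  qed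
qed

text \<open>
  The bound of the preceding lemma has a constant below \<open>1\<close> in each factor, which an infinite
  product does not tolerate. From a multiple of \<open>m\<close> on, the factors differ from \<open>1\<close> only by a
  multiple of \<open>m^2 / n^2\<close>.
\<close>

lemma far_factor_norm_ge:
  assumes \<rho>: "0 < \<rho>" "\<rho> < 2" and c: "norm c' \<le> \<Gamma>" and w: "norm w + \<Gamma> \<le> Y * (real m)\<^sup>2"
    and n: "n \<ge> 1" "6 * Y * (real m)\<^sup>2 \<le> (real n)\<^sup>2"
  shows "norm (temporal_poly \<rho> c' n w / of_nat n ^ 4) \<ge> exp (- 6 * Y * (real m)\<^sup>2 * (1 / (real n)\<^sup>2))"
proof -
  define s where "s = Y * (real m)\<^sup>2 / (real n)\<^sup>2"
  define t where "t = (norm w + \<Gamma>) / (real n)\<^sup>2"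
  have \<Gamma>: "\<Gamma> \<ge> 0" using c norm_ge_zero order.trans by blast
  have t: "t \<ge> 0" "t \<le> s" using w \<Gamma> by (auto simp: t_def s_def intro: divide_right_mono)
  have s: "s \<le> 1 / 6" using n by (simp add: s_def field_simps)
  have "norm (temporal_poly \<rho> c' n w / of_nat n ^ 4 - 1) \<le> (1 + t)\<^sup>2 - 1"
    using temporal_poly_normalised[OF \<rho> c n(1)] by (simp add: t_def)
  also have "\<dots> \<le> (1 + s)\<^sup>2 - 1" using t by (intro diff_mono power_mono) auto
  also have "\<dots> = s * (2 + s)" by (simp add: power2_eq_square algebra_simps)
  also have "\<dots> \<le> s * 3" using s t by (intro mult_left_mono) auto
  finally have "1 - 3 * s \<le> norm (temporal_poly \<rho> c' n w / of_nat n ^ 4)"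
    using norm_triangle_ineq2[of 1 "1 - temporal_poly \<rho> c' n w / of_nat n ^ 4"]
    by (simp add: norm_minus_commute)
  moreover have "exp (- 6 * s) \<le> 1 - 3 * s"
  proof -
    have "- (3 * s) - 2 * (3 * s)\<^sup>2 \<le> ln (1 - 3 * s)"
      using s t by (intro ln_one_minus_pos_lower_bound) auto
    moreover have "(3 * s) * (3 * s) \<le> (1 / 2) * (3 * s)" using s t by (intro mult_right_mono) auto
    ultimately have "- 6 * s \<le> ln (1 - 3 * s)" by (simp add: power2_eq_square)
    then have "exp (- 6 * s) \<le> exp (ln (1 - 3 * s))" by simp
    then show ?thesis using s by simp
  qed
  ultimately show ?thesis by (simp add: s_def mult.assoc)
qed

text \<open>
  The \<open>L m\<close> factors with \<open>n \<le> L m\<close> contribute a power \<open>L m\<close> of a constant and the inverse of a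
  binomial coefficient; for the others the sum of \<open>m^2 / n^2\<close> over \<open>n > L m\<close> is at most \<open>m\<close>.
\<close>

lemma exists_prod_lower_bound:
  assumes \<rho>: "0 < \<rho>" "\<rho> < 2" and \<Gamma>: "\<Gamma> \<ge> 0"
  obtains C :: real and L m1 :: nat where "C \<ge> 0"
    "\<And>m J c c' w. m \<ge> m1 \<Longrightarrow> J \<ge> L * m \<Longrightarrow> norm c \<le> \<Gamma> \<Longrightarrow> norm c' \<le> \<Gamma> \<Longrightarrow> temporal_poly \<rho> c m w = 0 \<Longrightarrow>
       (\<Prod>n\<in>{1..J} - {m}. norm (temporal_poly \<rho> c' n w / of_nat n ^ 4)) \<ge> exp (- C * real m)"
proof -
  obtain c1 \<kappa> :: real and m1 :: nat where c1: "0 < c1" "c1 \<le> 1" and m1: "m1 \<ge> 1"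
    and near: "\<And>m n c c' w. m \<ge> m1 \<Longrightarrow> n \<ge> 1 \<Longrightarrow> n \<noteq> m \<Longrightarrow> norm c \<le> \<Gamma> \<Longrightarrow> norm c' \<le> \<Gamma> \<Longrightarrow> temporal_poly \<rho> c m w = 0 \<Longrightarrow>
       norm (temporal_poly \<rho> c' n w / of_nat n ^ 4) \<ge> c1 * (\<bar>real n - real m\<bar> / real n)"
    using exists_root_separation[OF \<rho> \<Gamma>] by metis
  define Y where "Y = 3 + 2 * \<Gamma>"
  define L where "L = nat \<lceil>6 * Y\<rceil>"
  have Y: "Y \<ge> 3" using \<Gamma> by (simp add: Y_def)
  have L: "real L \<ge> 6 * Y" "L \<ge> 1" using Y unfolding L_def by linarith+
  define C where "C = L * ln (2 / c1) + 6 * Y"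
  show thesis
  proof
    show "C \<ge> 0" using c1 Y by (auto simp: C_def)
    fix m J :: nat and c c' w :: complex
    assume m: "m \<ge> m1" and J: "J \<ge> L * m" and c: "norm c \<le> \<Gamma>" "norm c' \<le> \<Gamma>" and root: "temporal_poly \<rho> c m w = 0"
    let ?f = "\<lambda>n. norm (temporal_poly \<rho> c' n w / of_nat n ^ 4)"
    have m_pos: "m \<ge> 1" "m \<le> L * m" "L * m \<ge> 1" using m m1 L by auto
    have "norm w + \<Gamma> * 1 \<le> (3 + \<Gamma>) * (real m)\<^sup>2 + \<Gamma> * (real m)\<^sup>2"
      using root_norm_le[OF \<rho> c(1) m_pos(1) root] m_pos \<Gamma> by (intro add_mono mult_left_mono) auto
    then have wY: "norm w + \<Gamma> \<le> Y * (real m)\<^sup>2" by (simp add: Y_def algebra_simps)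
    have split: "{1..J} - {m} = ({1..L*m} - {m}) \<union> {L*m<..J}" using J m_pos by auto
    have "(1 / 2) ^ (L * m) * c1 ^ (L * m) \<le> (\<Prod>n\<in>{1..L*m} - {m}. \<bar>real n - real m\<bar> / real n) * c1 ^ (L * m - 1)"
      using c1 prod_distance_ratio_ge[OF m_pos(1,2)] by (intro mult_mono power_decreasing prod_nonneg) auto
    also have "\<dots> = (\<Prod>n\<in>{1..L*m} - {m}. c1 * (\<bar>real n - real m\<bar> / real n))"
      unfolding prod.distrib using m_pos by simp
    also have "\<dots> \<le> (\<Prod>n\<in>{1..L*m} - {m}. ?f n)"
      using near[OF m _ _ c root] c1 by (intro prod_mono) auto
    finally have 1: "(1 / 2) ^ (L * m) * c1 ^ (L * m) \<le> (\<Prod>n\<in>{1..L*m} - {m}. ?f n)" .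
    have far: "exp (- 6 * Y * (real m)\<^sup>2 * (1 / (real n)\<^sup>2)) \<le> ?f n" if n: "n \<in> {L*m<..J}" for n
    proof (rule far_factor_norm_ge[OF \<rho> c(2) wY])
      show "n \<ge> 1" using n by simp
      have "real L * real m \<le> real n" using n by (simp flip: of_nat_mult)
      then have "(real L * real m)\<^sup>2 \<le> (real n)\<^sup>2" by (intro power_mono) auto
      moreover have "6 * Y * 1 \<le> real L * real L" using L Y by (intro mult_mono) auto
      then have "6 * Y * (real m)\<^sup>2 \<le> (real L * real L) * (real m)\<^sup>2" by (intro mult_right_mono) auto
      ultimately show "6 * Y * (real m)\<^sup>2 \<le> (real n)\<^sup>2" by (simp add: power2_eq_square mult_ac)
    qed
    have "(\<Sum>n\<in>{L*m<..J}. 1 / (real n)\<^sup>2) \<le> 1 / real (L * m)"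
      using sum_inverse_squares_le[OF m_pos(3) J] by (smt (verit) divide_nonneg_nonneg of_nat_0_le_iff)
    also have "\<dots> \<le> 1 / real m" using m_pos by (intro divide_left_mono) (auto simp flip: of_nat_mult)
    finally have "6 * Y * (real m)\<^sup>2 * (\<Sum>n\<in>{L*m<..J}. 1 / (real n)\<^sup>2) \<le> 6 * Y * (real m)\<^sup>2 * (1 / real m)"
      using Y by (intro mult_left_mono) auto
    also have "\<dots> = 6 * Y * real m" using m_pos by (simp add: power2_eq_square)
    finally have "exp (- 6 * Y * real m) \<le> exp (\<Sum>n\<in>{L*m<..J}. - 6 * Y * (real m)\<^sup>2 * (1 / (real n)\<^sup>2))"
      by (simp only: exp_le_cancel_iff sum_distrib_left[symmetric])
    also have "\<dots> = (\<Prod>n\<in>{L*m<..J}. exp (- 6 * Y * (real m)\<^sup>2 * (1 / (real n)\<^sup>2)))"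
      by (rule exp_sum) simp
    also have "\<dots> \<le> (\<Prod>n\<in>{L*m<..J}. ?f n)" using far by (intro prod_mono) auto
    finally have 2: "exp (- 6 * Y * real m) \<le> (\<Prod>n\<in>{L*m<..J}. ?f n)" .
    have "exp (- C * real m) = (1 / 2) ^ (L * m) * c1 ^ (L * m) * exp (- 6 * Y * real m)"
    proof -
      have "(1 / 2) ^ (L * m) * c1 ^ (L * m) = (c1 / 2) ^ (L * m)" by (simp add: power_divide)
      also have "c1 / 2 = exp (- ln (2 / c1))" using c1 by (simp add: exp_minus)
      also have "\<dots> ^ (L * m) = exp (real (L * m) * - ln (2 / c1))" by (rule exp_of_nat_mult[symmetric])
      finally show ?thesis by (simp add: C_def algebra_simps flip: exp_add)
    qed
    also have "\<dots> \<le> (\<Prod>n\<in>{1..L*m} - {m}. ?f n) * (\<Prod>n\<in>{L*m<..J}. ?f n)"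
      using 1 2 c1 by (intro mult_mono prod_nonneg) auto
    also have "\<dots> = (\<Prod>n\<in>{1..J} - {m}. ?f n)"
      unfolding split by (rule prod.union_disjoint[symmetric]) auto
    finally show "exp (- C * real m) \<le> (\<Prod>n\<in>{1..J} - {m}. ?f n)" .
  qed
qed

lemma power4_le_exp: "x \<ge> (0::real) \<Longrightarrow> x ^ 4 \<le> 24 * exp x"
  using power_times_exp_minus_le_fact[of x 4] by (simp add: exp_minus field_simps fact_numeral)

section \<open>The entire function attached to a root\<close>

text \<open>
  The single exponent \<open>\<nu>\<close> stands for a bound on all the block sizes: zeros of higher order than
  required do no harm.
\<close>

locale temporal_spectrum =
  fixes \<rho> :: real and p0 :: nat and \<gamma> :: "nat \<Rightarrow> complex" and \<alpha> :: complex and \<nu> :: nat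
  assumes \<rho>: "0 < \<rho>" "\<rho> < 2"
    and roots_distinct: "\<And>j k m n \<sigma> \<eta>. j \<in> {1..p0} \<Longrightarrow> k \<in> {1..p0} \<Longrightarrow> m \<ge> 1 \<Longrightarrow> n \<ge> 1 \<Longrightarrow>
           \<sigma> \<in> {Plus, Minus} \<Longrightarrow> \<eta> \<in> {Plus, Minus} \<Longrightarrow> (j, m) \<noteq> (k, n) \<Longrightarrow>
           temporal_root \<rho> (\<gamma> j) m \<sigma> \<noteq> temporal_root \<rho> (\<gamma> k) n \<eta>"
    and nonresonant: "\<And>j m \<sigma>. j \<in> {1..p0} \<Longrightarrow> m \<ge> 1 \<Longrightarrow> \<sigma> \<in> labels \<rho> (\<gamma> j) m \<Longrightarrow>
           (temporal_root \<rho> (\<gamma> j) m \<sigma>)\<^sup>2 + \<alpha> \<noteq> 0"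
begin

text \<open>
  Any common bound for the \<open>\<gamma> k\<close> would do.
\<close>

definition \<Gamma> :: real where "\<Gamma> = (\<Sum>k\<in>{1..p0}. norm (\<gamma> k))"

text \<open>
  The roots of level \<open>n = Suc i\<close>, except those of the pair \<open>(j, m)\<close> itself. Division by \<open>n^4\<close>
  normalises the factors to tend to \<open>1\<close>.
\<close>

definition level_factor :: "nat \<Rightarrow> nat \<Rightarrow> nat \<Rightarrow> complex \<Rightarrow> complex" where
  "level_factor j m i z =
     (\<Prod>k\<in>{k\<in>{1..p0}. (k, Suc i) \<noteq> (j, m)}. (temporal_poly \<rho> (\<gamma> k) (Suc i) z / of_nat (Suc i) ^ 4) ^ \<nu>)"

text \<open>
  The zero at the other root of the pair \<open>(j, m)\<close>; at a double root there is none.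
\<close>

fun companion_factor :: "nat \<Rightarrow> nat \<Rightarrow> label \<Rightarrow> complex \<Rightarrow> complex" where
  "companion_factor j m Plus z = (z - temporal_root \<rho> (\<gamma> j) m Minus) ^ \<nu>"
| "companion_factor j m Minus z = (z - temporal_root \<rho> (\<gamma> j) m Plus) ^ \<nu>"
| "companion_factor j m Crit z = 1"

text \<open>
  The factor \<open>z\<^sup>2 + \<alpha>\<close> has the zeros \<open>\<omega>\<close> and \<open>-\<omega>\<close>, which merge into a double zero for
  \<open>\<omega> = 0\<close>; this matches the definition of \<^const>\<open>chi\<close> in both cases.
\<close>

definition symbol :: "nat \<Rightarrow> nat \<Rightarrow> label \<Rightarrow> complex \<Rightarrow> complex" where
  "symbol j m \<sigma> z = (z\<^sup>2 + \<alpha>) * companion_factor j m \<sigma> z * (\<Prod>i. level_factor j m i z)"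

lemma \<Gamma>_nonneg: "\<Gamma> \<ge> 0"
  unfolding \<Gamma>_def by (intro sum_nonneg) auto

lemma norm_\<gamma>_le: "k \<in> {1..p0} \<Longrightarrow> norm (\<gamma> k) \<le> \<Gamma>"
  unfolding \<Gamma>_def by (rule member_le_sum) auto

lemma label_root_cases:
  assumes "\<sigma> \<in> labels \<rho> c m"
  obtains \<sigma>' where "\<sigma>' \<in> {Plus, Minus}" "temporal_root \<rho> c m \<sigma> = temporal_root \<rho> c m \<sigma>'"
  using assms temporal_root_Crit(1)[of \<rho> c m] that[of \<sigma>] that[of Plus]
  by (auto simp: labels_def split: if_splits simp del: temporal_root.simps)

lemma temporal_poly_root:
  assumes "\<sigma> \<in> labels \<rho> c m"
  shows "temporal_poly \<rho> c m (temporal_root \<rho> c m \<sigma>) = 0"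
proof -
  obtain \<sigma>' where "\<sigma>' \<in> {Plus, Minus}" "temporal_root \<rho> c m \<sigma> = temporal_root \<rho> c m \<sigma>'"
    using label_root_cases[OF assms] .
  then show ?thesis unfolding temporal_poly_factor by auto
qed

lemma temporal_poly_holomorphic: "temporal_poly \<rho> c n holomorphic_on A"
  unfolding temporal_poly_def[abs_def] by (intro holomorphic_intros)

lemma companion_factor_holomorphic: "companion_factor j m \<sigma> holomorphic_on A"
  by (cases \<sigma>) (auto simp del: temporal_root.simps simp: companion_factor.simps[abs_def] intro!: holomorphic_intros)

lemma level_factor_majorised: "majorised \<Gamma> (2 * \<nu> * p0) (level_factor j m)"
  unfolding majorised_def
proof (intro conjI allI)
  show "\<Gamma> \<ge> 0" by (rule \<Gamma>_nonneg)
  show "level_factor j m i holomorphic_on UNIV" for i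
    unfolding level_factor_def[abs_def] 
    by (intro holomorphic_intros temporal_poly_holomorphic) (auto simp del: of_nat_Suc)
  fix i and z :: complex
  let ?y = "1 + (norm z + \<Gamma>) / (real (Suc i))\<^sup>2"
  let ?I = "{k\<in>{1..p0}. (k, Suc i) \<noteq> (j, m)}"
  have "norm (level_factor j m i z - 1) \<le> (\<Prod>k\<in>?I. (?y\<^sup>2) ^ \<nu>) - 1"
    unfolding level_factor_def
    by (intro norm_prod_minus_one_le norm_power_minus_one_le temporal_poly_normalised \<rho> norm_\<gamma>_le) auto
  also have "(\<Prod>k\<in>?I. (?y\<^sup>2) ^ \<nu>) = ?y ^ (2 * \<nu> * card ?I)" by (simp only: prod_constant power_mult)
  also have "\<dots> \<le> ?y ^ (2 * \<nu> * p0)"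
  proof (rule power_increasing)
    have "card ?I \<le> card {1..p0}" by (intro card_mono) auto
    then show "2 * \<nu> * card ?I \<le> 2 * \<nu> * p0" by simp
  qed (use \<Gamma>_nonneg in auto)
  finally show "norm (level_factor j m i z - 1) \<le> ?y ^ (2 * \<nu> * p0) - 1" by simp
qed

lemma symbol_holomorphic: "symbol j m \<sigma> holomorphic_on UNIV"
  unfolding symbol_def[abs_def]
  by (intro holomorphic_intros companion_factor_holomorphic majorised_prodinf_holomorphic[OF level_factor_majorised])

text \<open>
  All the factors are measured against \<open>t = sqrt |z| + m\<close>. Polynomial factors in \<open>|z|\<close> and \<open>m\<close> are
  bounded by powers of \<open>exp t\<close>.
\<close>

lemma symbol_norm_le:
  obtains K C where "K > 0" "C \<ge> 0"
    "\<And>j m \<sigma> z. j \<in> {1..p0} \<Longrightarrow> m \<ge> 1 \<Longrightarrow> norm (symbol j m \<sigma> z) \<le> K * exp (C * (sqrt (norm z) + real m))"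
proof
  define X where "X = 3 + \<Gamma>"
  define N where "N = real (2 * \<nu> * p0)"
  define K where "K = (4 + norm \<alpha>) * (2 * (1 + X)) ^ \<nu> * exp (N * pi * (1 + sqrt \<Gamma>))"
  have X: "X > 0" using \<Gamma>_nonneg by (simp add: X_def)
  have N: "N \<ge> 0" by (simp add: N_def)
  show "K > 0" using X by (auto simp: K_def intro!: mult_pos_pos add_pos_nonneg)
  show "2 + real \<nu> + N * pi \<ge> 0" using N by simp
  fix j m \<sigma> and z :: complex
  assume j: "j \<in> {1..p0}" and m: "m \<ge> (1::nat)"
  define t where "t = sqrt (norm z) + real m"
  have t: "t \<ge> 0" "sqrt (norm z) \<le> t" "real m \<le> t" by (auto simp: t_def)
  have z: "norm z \<le> 2 * exp t"
    using le_two_exp_sqrt[of "norm z"] t(2) by (smt (verit) exp_le_cancel_iff norm_ge_zero)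
  have m2: "(real m)\<^sup>2 \<le> 2 * exp t"
    using power2_le_two_exp[of "real m"] t(3) by (smt (verit) exp_le_cancel_iff of_nat_0_le_iff)
  have e1: "exp (2 * t) \<ge> 1" using t by simp
  have "norm (z\<^sup>2 + \<alpha>) \<le> (norm z)\<^sup>2 + norm \<alpha>"
    using norm_triangle_ineq[of "z\<^sup>2" \<alpha>] by (simp add: norm_power)
  also have "(norm z)\<^sup>2 \<le> (2 * exp t)\<^sup>2" using z by (intro power_mono) auto
  also have "(2 * exp t)\<^sup>2 = 4 * exp (2 * t)" by (simp add: power_mult_distrib exp_double)
  also have "norm \<alpha> \<le> norm \<alpha> * exp (2 * t)" using e1 mult_left_mono[of 1 "exp (2 * t)" "norm \<alpha>"] by simp
  finally have 1: "norm (z\<^sup>2 + \<alpha>) \<le> (4 + norm \<alpha>) * exp (2 * t)" by (simp add: algebra_simps)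
  have base: "1 \<le> 2 * (1 + X) * exp t" using t X mult_mono[of 1 "2 * (1 + X)" 1 "exp t"] by simp
  have root: "norm (z - temporal_root \<rho> (\<gamma> j) m \<eta>) \<le> 2 * (1 + X) * exp t" if "\<eta> \<in> {Plus, Minus}" for \<eta>
  proof -
    have "temporal_poly \<rho> (\<gamma> j) m (temporal_root \<rho> (\<gamma> j) m \<eta>) = 0"
      unfolding temporal_poly_factor using that by auto
    then have "norm (temporal_root \<rho> (\<gamma> j) m \<eta>) \<le> X * (real m)\<^sup>2"
      unfolding X_def using root_norm_le \<rho> norm_\<gamma>_le[OF j] m by blast
    also have "\<dots> \<le> X * (2 * exp t)" using X m2 by (intro mult_left_mono) auto
    finally show ?thesis
      using z norm_triangle_ineq4[of z "temporal_root \<rho> (\<gamma> j) m \<eta>"] by (simp add: algebra_simps)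
  qed
  have "norm (companion_factor j m \<sigma> z) \<le> (2 * (1 + X) * exp t) ^ \<nu>"
  proof (cases \<sigma>)
    case Crit
    then show ?thesis using base by (simp add: one_le_power)
  qed (use root in \<open>auto simp del: temporal_root.simps simp: norm_power intro!: power_mono\<close>)
  also have "\<dots> = (2 * (1 + X)) ^ \<nu> * exp (real \<nu> * t)"
    by (simp only: power_mult_distrib exp_of_nat_mult)
  finally have 2: "norm (companion_factor j m \<sigma> z) \<le> (2 * (1 + X)) ^ \<nu> * exp (real \<nu> * t)" .
  have "sqrt (norm z + \<Gamma>) \<le> sqrt (norm z) + sqrt \<Gamma>" using \<Gamma>_nonneg by (intro sqrt_add_le_add_sqrt) auto
  also have "\<dots> \<le> t + sqrt \<Gamma>" using t by simp
  finally have "N * pi * (1 + sqrt (norm z + \<Gamma>)) \<le> N * pi * (1 + (t + sqrt \<Gamma>))"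
    using N by (intro mult_left_mono) auto
  also have "\<dots> = N * pi * (1 + sqrt \<Gamma>) + N * pi * t" by (simp add: algebra_simps)
  finally have 3: "norm (\<Prod>i. level_factor j m i z) \<le> exp (N * pi * (1 + sqrt \<Gamma>)) * exp (N * pi * t)"
    using majorised_prodinf_norm_le[OF level_factor_majorised, of j m z]
    unfolding exp_add[symmetric] N_def by (meson exp_le_cancel_iff order.trans)
  have "norm (symbol j m \<sigma> z) \<le> ((4 + norm \<alpha>) * exp (2 * t)) * ((2 * (1 + X)) ^ \<nu> * exp (real \<nu> * t))
      * (exp (N * pi * (1 + sqrt \<Gamma>)) * exp (N * pi * t))"
    unfolding symbol_def norm_mult using 1 2 3 X by (intro mult_mono) auto
  also have "\<dots> = K * (exp (2 * t) * exp (real \<nu> * t) * exp (N * pi * t))" by (simp add: K_def)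
  also have "exp (2 * t) * exp (real \<nu> * t) * exp (N * pi * t) = exp ((2 + real \<nu> + N * pi) * t)"
    by (simp add: distrib_right exp_add)
  finally show "norm (symbol j m \<sigma> z) \<le> K * exp ((2 + real \<nu> + N * pi) * (sqrt (norm z) + real m))"
    by (simp only: t_def)
qed

text \<open>
  The level \<open>n\<close> occurs in finitely many of the factors, and it is split off from the product. At a
  double root \<open>p_{k,n}^\<nu>\<close> itself has a zero of order \<open>2 \<nu>\<close>.
\<close>

lemma symbol_vanishes_at_other_level:
  assumes p: "p \<in> {1..p0}" and n: "n \<ge> 1" and ne: "(p, n) \<noteq> (j, m)" and \<eta>: "\<eta> \<in> labels \<rho> (\<gamma> p) n"
  shows "vanishes_to_order (symbol j m \<sigma>) (temporal_root \<rho> (\<gamma> p) n \<eta>) (if \<eta> = Crit then 2 * \<nu> else \<nu>)"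
proof -
  define v where "v = temporal_root \<rho> (\<gamma> p) n \<eta>"
  define e where "e = (if \<eta> = Crit then 2 * \<nu> else \<nu>)"
  obtain i where i: "n = Suc i" using n by (cases n) auto
  let ?I = "{k\<in>{1..p0}. (k, Suc i) \<noteq> (j, m)}"
  let ?x = "\<lambda>k z. (temporal_poly \<rho> (\<gamma> k) (Suc i) z / of_nat (Suc i) ^ 4) ^ \<nu>"
  have hol: "?x k holomorphic_on UNIV" for k
    by (intro holomorphic_intros temporal_poly_holomorphic) (auto simp del: of_nat_Suc)
  have "vanishes_to_order (\<lambda>z. temporal_poly \<rho> (\<gamma> p) n z ^ \<nu>) v e"
  proof (cases "\<eta> = Crit")
    case True
    then have "double_root \<rho> (\<gamma> p) n" using \<eta> by (auto simp: labels_def split: if_splits)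
    then have "temporal_poly \<rho> (\<gamma> p) n z ^ \<nu> = (z - v) ^ e" for z
      using True temporal_root_Crit unfolding temporal_poly_factor v_def e_def
      by (simp add: power_mult power2_eq_square del: temporal_root.simps)
    then show ?thesis by (simp add: vanishes_to_order_power)
  next
    case False
    define v' where "v' = (if \<eta> = Plus then temporal_root \<rho> (\<gamma> p) n Minus else temporal_root \<rho> (\<gamma> p) n Plus)"
    have "temporal_poly \<rho> (\<gamma> p) n z ^ \<nu> = (z - v) ^ e * (z - v') ^ \<nu>" for z
      using False unfolding temporal_poly_factor v_def e_def v'_def
      by (cases \<eta>) (auto simp: power_mult_distrib simp del: temporal_root.simps)
    moreover have "(\<lambda>z. (z - v') ^ \<nu>) holomorphic_on UNIV" by (intro holomorphic_intros)
    ultimately show ?thesis using vanishes_to_order_mult(1)[OF vanishes_to_order_power] by simp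
  qed
  then have "vanishes_to_order (\<lambda>z. temporal_poly \<rho> (\<gamma> p) n z ^ \<nu> * (1 / (of_nat n ^ 4) ^ \<nu>)) v e"
    by (rule vanishes_to_order_mult) auto
  then have x: "vanishes_to_order (?x p) v e" by (simp add: i power_divide)
  have "vanishes_to_order (\<lambda>z. ?x p z * (\<Prod>k\<in>?I - {p}. ?x k z)) v e"
    by (rule vanishes_to_order_mult[OF x]) (intro holomorphic_intros hol)
  moreover have "level_factor j m i z = ?x p z * (\<Prod>k\<in>?I - {p}. ?x k z)" for z
    unfolding level_factor_def by (rule prod.remove) (use p ne i in auto)
  ultimately have lf: "vanishes_to_order (\<lambda>z. level_factor j m i z) v e" by simp
  have lh: "level_factor j m i holomorphic_on UNIV" for i
    using level_factor_majorised unfolding majorised_def by blast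
  define G where "G z = (z\<^sup>2 + \<alpha>) * companion_factor j m \<sigma> z *
     ((\<Prod>l<i. level_factor j m l z) * (\<Prod>l. level_factor j m (l + Suc i) z))" for z
  have "G holomorphic_on UNIV"
    unfolding G_def[abs_def]
    by (intro holomorphic_intros companion_factor_holomorphic lh
        majorised_prodinf_holomorphic[OF majorised_shift[OF level_factor_majorised]])
  then have "vanishes_to_order (\<lambda>z. level_factor j m i z * G z) v e"
    by (rule vanishes_to_order_mult[OF lf])
  moreover have "symbol j m \<sigma> z = level_factor j m i z * G z" for z
    using majorised_prodinf_split[OF level_factor_majorised, of j m z "Suc i"]
    by (simp add: symbol_def G_def)
  ultimately have "vanishes_to_order (symbol j m \<sigma>) v e" by (simp add: fun_eq_iff[symmetric] vanishes_to_order_def)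
  then show ?thesis by (simp only: v_def e_def)
qed

lemma symbol_vanishes_at_companion:
  assumes "\<sigma> \<in> labels \<rho> (\<gamma> j) m" "\<eta> \<in> labels \<rho> (\<gamma> j) m" "\<eta> \<noteq> \<sigma>"
  shows "\<eta> \<noteq> Crit" "vanishes_to_order (symbol j m \<sigma>) (temporal_root \<rho> (\<gamma> j) m \<eta>) \<nu>"
proof -
  have *: "\<eta> = Plus \<and> \<sigma> = Minus \<or> \<eta> = Minus \<and> \<sigma> = Plus"
    using assms by (auto simp: labels_def split: if_splits)
  then show "\<eta> \<noteq> Crit" by auto
  define v where "v = temporal_root \<rho> (\<gamma> j) m \<eta>"
  have c: "companion_factor j m \<sigma> z = (z - v) ^ \<nu>" for z using * by (auto simp: v_def)
  have "(\<lambda>z. \<Prod>i. level_factor j m i z) holomorphic_on UNIV"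
    by (rule majorised_prodinf_holomorphic[OF level_factor_majorised])
  moreover have "(\<lambda>z. z\<^sup>2 + \<alpha>) holomorphic_on UNIV" by (intro holomorphic_intros)
  ultimately have "vanishes_to_order (\<lambda>z. (z\<^sup>2 + \<alpha>) * (z - v) ^ \<nu> * (\<Prod>i. level_factor j m i z)) v \<nu>"
    by (intro vanishes_to_order_mult vanishes_to_order_power)
  then show "vanishes_to_order (symbol j m \<sigma>) (temporal_root \<rho> (\<gamma> j) m \<eta>) \<nu>"
    unfolding symbol_def[abs_def] c v_def .
qed

lemma symbol_vanishes_at_chi:
  assumes "\<omega>\<^sup>2 = - \<alpha>"
  shows "vanishes_to_order (symbol j m \<sigma>) \<omega> (if \<omega> = 0 then 2 else 1)"
proof -
  define G where "G z = companion_factor j m \<sigma> z * (\<Prod>i. level_factor j m i z)" for z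
  have G: "G holomorphic_on UNIV"
    unfolding G_def[abs_def]
    by (intro holomorphic_intros companion_factor_holomorphic majorised_prodinf_holomorphic[OF level_factor_majorised])
  have \<alpha>: "\<alpha> = - \<omega>\<^sup>2" using assms by simp
  define e :: nat where "e = (if \<omega> = 0 then 2 else 1)"
  have q: "z\<^sup>2 + \<alpha> = (z - \<omega>) ^ e * (if \<omega> = 0 then 1 else z + \<omega>)" for z
    by (simp add: \<alpha> e_def power2_eq_square algebra_simps)
  have "(\<lambda>z. (if \<omega> = 0 then 1 else z + \<omega>) * G z) holomorphic_on UNIV"
    by (cases "\<omega> = 0") (auto intro!: holomorphic_intros G)
  moreover have "symbol j m \<sigma> z = (z - \<omega>) ^ e * ((if \<omega> = 0 then 1 else z + \<omega>) * G z)" for z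
    unfolding symbol_def q G_def by (simp only: mult.assoc)
  ultimately show ?thesis unfolding vanishes_to_order_def e_def by blast
qed

lemma symbol_nonzero:
  assumes j: "j \<in> {1..p0}" and m: "m \<ge> 1" and \<sigma>: "\<sigma> \<in> labels \<rho> (\<gamma> j) m"
  shows "symbol j m \<sigma> (temporal_root \<rho> (\<gamma> j) m \<sigma>) \<noteq> 0"
proof -
  define w where "w = temporal_root \<rho> (\<gamma> j) m \<sigma>"
  obtain \<sigma>' where \<sigma>': "\<sigma>' \<in> {Plus, Minus}" "w = temporal_root \<rho> (\<gamma> j) m \<sigma>'"
    using label_root_cases[OF \<sigma>] unfolding w_def .
  have "temporal_poly \<rho> (\<gamma> k) n w \<noteq> 0" if "k \<in> {1..p0}" "n \<ge> 1" "(k, n) \<noteq> (j, m)" for k n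
    using roots_distinct[OF j that(1) m that(2) \<sigma>'(1), of Plus] roots_distinct[OF j that(1) m that(2) \<sigma>'(1), of Minus] that(3)
    unfolding temporal_poly_factor \<sigma>'(2) by (auto simp del: temporal_root.simps)
  then have "level_factor j m i w \<noteq> 0" for i
    unfolding level_factor_def by (auto simp del: of_nat_Suc)
  then have "(\<Prod>i. level_factor j m i w) \<noteq> 0"
    by (intro prodinf_nonzero majorised_convergent_prod[OF level_factor_majorised])
  moreover have "companion_factor j m \<sigma> w \<noteq> 0"
    using \<sigma> by (cases \<sigma>) (auto simp: labels_def double_root_def w_def simp del: temporal_root.simps split: if_splits)
  ultimately show ?thesis
    using nonresonant[OF j m \<sigma>] by (simp add: symbol_def w_def)
qed

text \<open>
  The \<open>\<gamma> k\<close> are distinct because equal values would have equal roots of level \<open>1\<close>.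
\<close>

lemma eigenvalue_gap:
  obtains g where "0 < g" "g \<le> 1" "\<And>j k. j \<in> {1..p0} \<Longrightarrow> k \<in> {1..p0} \<Longrightarrow> k \<noteq> j \<Longrightarrow> g \<le> norm (\<gamma> k - \<gamma> j)"
proof -
  define A where "A = insert 1 ((\<lambda>(j, k). norm (\<gamma> k - \<gamma> j)) ` {(j, k) \<in> {1..p0} \<times> {1..p0}. k \<noteq> j})"
  have "finite {(j, k) \<in> {1..p0} \<times> {1..p0}. k \<noteq> j}"
    by (rule finite_subset[of _ "{1..p0} \<times> {1..p0}"]) auto
  then have A: "finite A" "A \<noteq> {}" unfolding A_def by blast+
  have pos: "norm (\<gamma> k - \<gamma> j) > 0" if "j \<in> {1..p0}" "k \<in> {1..p0}" "k \<noteq> j" for j k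
    using roots_distinct[OF that(1,2), of 1 1 Plus Plus] that(3) by auto
  show thesis
  proof (rule that[of "Min A"])
    show "0 < Min A" using A pos by (auto simp: A_def)
    show "Min A \<le> 1" using A by (auto simp: A_def)
    show "Min A \<le> norm (\<gamma> k - \<gamma> j)" if "j \<in> {1..p0}" "k \<in> {1..p0}" "k \<noteq> j" for j k
      using A that by (intro Min_le) (auto simp: A_def image_iff)
  qed
qed

text \<open>
  Rearranged as a product over \<open>k\<close> of products over \<open>n \<noteq> m\<close>, the partial products are bounded by
  \<open>exists_prod_lower_bound\<close>. The remaining factors, those of level \<open>m\<close>, are the numbers
  \<open>(\<gamma>_k - \<gamma>_j) / m^4\<close>: roots of the same level approach each other, but only polynomially.
\<close>

lemma level_product_lower_bound:
  obtains C c :: real and m1 :: nat where "C \<ge> 0" "c > 0"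
    "\<And>j m w. j \<in> {1..p0} \<Longrightarrow> m \<ge> m1 \<Longrightarrow> m \<ge> 1 \<Longrightarrow> temporal_poly \<rho> (\<gamma> j) m w = 0 \<Longrightarrow>
       norm (\<Prod>i. level_factor j m i w) \<ge> c * exp (- C * real m)"
proof -
  obtain C0 :: real and L m1 :: nat where C0: "C0 \<ge> 0"
    and low: "\<And>m J c c' w. m \<ge> m1 \<Longrightarrow> J \<ge> L * m \<Longrightarrow> norm c \<le> \<Gamma> \<Longrightarrow> norm c' \<le> \<Gamma> \<Longrightarrow> temporal_poly \<rho> c m w = 0 \<Longrightarrow>
       (\<Prod>n\<in>{1..J} - {m}. norm (temporal_poly \<rho> c' n w / of_nat n ^ 4)) \<ge> exp (- C0 * real m)"
    using that by (rule exists_prod_lower_bound[OF \<rho> \<Gamma>_nonneg])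
  obtain g where g: "0 < g" "g \<le> 1" "\<And>j k. j \<in> {1..p0} \<Longrightarrow> k \<in> {1..p0} \<Longrightarrow> k \<noteq> j \<Longrightarrow> g \<le> norm (\<gamma> k - \<gamma> j)"
    using that by (rule eigenvalue_gap)
  define N where "N = \<nu> * p0"
  show thesis
  proof (rule that[of "N * (C0 + 1)" "(g / 24) ^ N" m1])
    show "N * (C0 + 1) \<ge> 0" "(g / 24) ^ N > 0" using C0 g by auto
    fix j m and w :: complex
    assume j: "j \<in> {1..p0}" and m: "m \<ge> m1" "m \<ge> 1" and root: "temporal_poly \<rho> (\<gamma> j) m w = 0"
    define a where "a k n = norm (temporal_poly \<rho> (\<gamma> k) n w / of_nat n ^ 4) ^ \<nu>" for k n
    define y where "y = g / 24 * exp (- real m)"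
    have y: "0 < y" "y \<le> 1"
    proof -
      have "g / 24 * exp (- real m) \<le> 1 * 1" using g by (intro mult_mono) auto
      then show "0 < y" "y \<le> 1" using g by (auto simp: y_def)
    qed
    \<comment> \<open>at \<open>n = m\<close> the polynomial for \<open>\<gamma> k\<close> takes the value \<open>\<gamma> k - \<gamma> j\<close>\<close>
    have same_level: "a k m \<ge> y ^ \<nu>" if k: "k \<in> {1..p0}" "k \<noteq> j" for k
    proof -
      have "temporal_poly \<rho> (\<gamma> k) m w = \<gamma> k - \<gamma> j"
        using temporal_poly_difference[OF root, of "\<gamma> k" m] by simp
      then have "norm (temporal_poly \<rho> (\<gamma> k) m w / of_nat m ^ 4) = norm (\<gamma> k - \<gamma> j) / real m ^ 4"
        by (simp add: norm_divide norm_power)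
      also have "\<dots> \<ge> g / (24 * exp (real m))"
        using g j k m power4_le_exp[of "real m"] by (intro frac_le) auto
      finally have "g / (24 * exp (real m)) \<le> norm (temporal_poly \<rho> (\<gamma> k) m w / of_nat m ^ 4)" .
      moreover have "y = g / (24 * exp (real m))" by (simp add: y_def exp_minus field_simps)
      ultimately have "y \<le> norm (temporal_poly \<rho> (\<gamma> k) m w / of_nat m ^ 4)" by (simp only:)
      then show ?thesis unfolding a_def using y by (intro power_mono) auto
    qed
    have partial: "(g / 24) ^ N * exp (- (N * (C0 + 1)) * real m) \<le> norm (\<Prod>i<J. level_factor j m i w)"
      if J: "J \<ge> L * m" "J \<ge> m" for J
    proof -
      have "norm (\<Prod>i<J. level_factor j m i w) = (\<Prod>i<J. \<Prod>k\<in>{k\<in>{1..p0}. (k, Suc i) \<noteq> (j, m)}. a k (Suc i))"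
        by (simp only: prod_norm[symmetric] level_factor_def norm_power a_def)
      also have "\<dots> = (\<Prod>n\<in>{1..J}. \<Prod>k\<in>{k\<in>{1..p0}. (k, n) \<noteq> (j, m)}. a k n)"
        by (rule prod.reindex_bij_witness[of _ "\<lambda>n. n - 1" Suc]) auto
      also have "\<dots> = (\<Prod>k\<in>{k\<in>{1..p0}. (k, m) \<noteq> (j, m)}. a k m) * (\<Prod>n\<in>{1..J} - {m}. \<Prod>k\<in>{k\<in>{1..p0}. (k, n) \<noteq> (j, m)}. a k n)"
        by (rule prod.remove) (use m J in auto)
      also have "(\<Prod>k\<in>{k\<in>{1..p0}. (k, m) \<noteq> (j, m)}. a k m) = (\<Prod>k\<in>{1..p0} - {j}. a k m)"
        by (rule prod.cong) auto
      also have "(\<Prod>n\<in>{1..J} - {m}. \<Prod>k\<in>{k\<in>{1..p0}. (k, n) \<noteq> (j, m)}. a k n) = (\<Prod>n\<in>{1..J} - {m}. \<Prod>k\<in>{1..p0}. a k n)"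
        by (intro prod.cong) auto
      also have "\<dots> = (\<Prod>k\<in>{1..p0}. \<Prod>n\<in>{1..J} - {m}. a k n)" by (rule prod.swap)
      finally have eq: "norm (\<Prod>i<J. level_factor j m i w)
          = (\<Prod>k\<in>{1..p0} - {j}. a k m) * (\<Prod>k\<in>{1..p0}. \<Prod>n\<in>{1..J} - {m}. a k n)" .
      have "y ^ N \<le> y ^ (\<nu> * (p0 - 1))" using y by (intro power_decreasing) (auto simp: N_def)
      also have "\<dots> = (\<Prod>k\<in>{1..p0} - {j}. y ^ \<nu>)" using j by (simp add: power_mult)
      also have "\<dots> \<le> (\<Prod>k\<in>{1..p0} - {j}. a k m)" using same_level y by (intro prod_mono) auto
      finally have 1: "y ^ N \<le> (\<Prod>k\<in>{1..p0} - {j}. a k m)" .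
      have "(exp (- C0 * real m)) ^ N = (\<Prod>k\<in>{1..p0}. (exp (- C0 * real m)) ^ \<nu>)"
        by (simp only: prod_constant card_atLeastAtMost N_def power_mult) simp
      also have "\<dots> \<le> (\<Prod>k\<in>{1..p0}. \<Prod>n\<in>{1..J} - {m}. a k n)"
      proof (intro prod_mono conjI)
        fix k assume k: "k \<in> {1..p0}"
        have "(exp (- C0 * real m)) ^ \<nu> \<le> (\<Prod>n\<in>{1..J} - {m}. norm (temporal_poly \<rho> (\<gamma> k) n w / of_nat n ^ 4)) ^ \<nu>"
          using low[OF m(1) J(1) norm_\<gamma>_le[OF j] norm_\<gamma>_le[OF k] root] by (intro power_mono) auto
        then show "(exp (- C0 * real m)) ^ \<nu> \<le> (\<Prod>n\<in>{1..J} - {m}. a k n)"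
          unfolding a_def by (simp only: prod_power_distrib)
      qed auto
      finally have 2: "(exp (- C0 * real m)) ^ N \<le> (\<Prod>k\<in>{1..p0}. \<Prod>n\<in>{1..J} - {m}. a k n)" .
      have "(g / 24) ^ N * exp (- (N * (C0 + 1)) * real m) = y ^ N * (exp (- C0 * real m)) ^ N"
      proof -
        have "y ^ N * (exp (- C0 * real m)) ^ N = (g / 24) ^ N * ((exp (- real m) * exp (- C0 * real m)) ^ N)"
          unfolding y_def by (simp only: power_mult_distrib mult.assoc)
        also have "(exp (- real m) * exp (- C0 * real m)) ^ N = exp (- (N * (C0 + 1)) * real m)"
          unfolding exp_add[symmetric] exp_of_nat_mult[symmetric] by (simp add: algebra_simps)
        finally show ?thesis by simp
      qed
      also have "\<dots> \<le> norm (\<Prod>i<J. level_factor j m i w)"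
        unfolding eq using 1 2 y by (intro mult_mono) (auto intro!: prod_nonneg simp: a_def)
      finally show ?thesis .
    qed
    show "norm (\<Prod>i. level_factor j m i w) \<ge> (g / 24) ^ N * exp (- (N * (C0 + 1)) * real m)"
    proof (rule LIMSEQ_le_const[OF tendsto_norm[OF majorised_prodinf_tendsto[OF level_factor_majorised, of j m w]]])
      show "\<exists>J0. \<forall>J\<ge>J0. (g / 24) ^ N * exp (- (N * (C0 + 1)) * real m) \<le> norm (\<Prod>i<J. level_factor j m i w)"
        using partial by (intro exI[of _ "max (L * m) m"]) auto
    qed
  qed
qed

text \<open>
  For large \<open>m\<close> the other factors are at least \<open>1\<close>: the size of \<open>Im w\<close> keeps \<open>w\<close> away from the
  other root of its pair and from \<open>\<omega>\<close>, \<open>-\<omega>\<close>. For the finitely many remaining indices it suffices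
  that the value is not \<open>0\<close>.
\<close>

lemma symbol_lower_bound:
  obtains C c :: real where "C \<ge> 0" "c > 0"
    "\<And>j m \<sigma>. j \<in> {1..p0} \<Longrightarrow> m \<ge> 1 \<Longrightarrow> \<sigma> \<in> labels \<rho> (\<gamma> j) m \<Longrightarrow>
       norm (symbol j m \<sigma> (temporal_root \<rho> (\<gamma> j) m \<sigma>)) \<ge> c * exp (- C * real m)"
proof -
  obtain C c1 :: real and m1 :: nat where C: "C \<ge> 0" "c1 > 0"
    and level: "\<And>j m w. j \<in> {1..p0} \<Longrightarrow> m \<ge> m1 \<Longrightarrow> m \<ge> 1 \<Longrightarrow> temporal_poly \<rho> (\<gamma> j) m w = 0 \<Longrightarrow>
       norm (\<Prod>i. level_factor j m i w) \<ge> c1 * exp (- C * real m)"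
    using that by (rule level_product_lower_bound)
  obtain \<kappa> :: real and m2 :: nat where \<kappa>: "\<kappa> > 0"
    and im: "\<And>m c w. m \<ge> m2 \<Longrightarrow> norm c \<le> \<Gamma> \<Longrightarrow> temporal_poly \<rho> c m w = 0 \<Longrightarrow> \<bar>Im w\<bar> \<ge> \<kappa> * (real m)\<^sup>2"
    using exists_root_separation[OF \<rho> \<Gamma>_nonneg] by metis
  define m3 where "m3 = Suc (nat \<lceil>(2 + norm \<alpha>) / \<kappa>\<rceil>)"
  define m0 where "m0 = max m1 (max m2 m3)"
  have large: "norm (symbol j m \<sigma> (temporal_root \<rho> (\<gamma> j) m \<sigma>)) \<ge> c1 * exp (- C * real m)"
    if j: "j \<in> {1..p0}" and m: "m \<ge> m0" and \<sigma>: "\<sigma> \<in> labels \<rho> (\<gamma> j) m" for j m \<sigma>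
  proof -
    define w where "w = temporal_root \<rho> (\<gamma> j) m \<sigma>"
    have m': "m \<ge> m1" "m \<ge> m2" "m \<ge> m3" "m \<ge> 1" using m by (auto simp: m0_def m3_def)
    have root: "temporal_poly \<rho> (\<gamma> j) m w = 0" unfolding w_def by (rule temporal_poly_root[OF \<sigma>])
    have "(2 + norm \<alpha>) / \<kappa> \<le> real m" using m'(3) unfolding m3_def by linarith
    also have "real m \<le> (real m)\<^sup>2" using m'(4) by (simp add: power2_eq_square)
    finally have "2 + norm \<alpha> \<le> \<kappa> * (real m)\<^sup>2" using \<kappa> by (simp add: field_simps)
    also have "\<dots> \<le> \<bar>Im w\<bar>" using im[OF m'(2) norm_\<gamma>_le[OF j] root] .
    finally have Im: "2 + norm \<alpha> \<le> \<bar>Im w\<bar>" .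
    have "2 + norm \<alpha> \<le> norm w" using Im abs_Im_le_cmod[of w] by linarith
    moreover have "norm w * 1 \<le> norm w * norm w"
      using calculation norm_ge_zero[of \<alpha>] by (intro mult_left_mono) linarith+
    ultimately have "1 \<le> norm (w\<^sup>2) - norm \<alpha>" by (simp add: norm_mult power2_eq_square)
    also have "\<dots> \<le> norm (w\<^sup>2 + \<alpha>)" using norm_diff_ineq[of "w\<^sup>2" \<alpha>] by simp
    finally have 1: "1 \<le> norm (w\<^sup>2 + \<alpha>)" .
    \<comment> \<open>the sum of the two roots is real, so their imaginary parts are opposite\<close>
    have far: "1 \<le> norm (w - v)" if "w + v = - of_real \<rho> * of_nat m ^ 2" for v
    proof -
      have "v = of_real (- \<rho> * (real m)\<^sup>2) - w" using that by (simp add: eq_diff_eq add.commute)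
      then have "Im (w - v) = 2 * Im w" by simp
      then have "2 * \<bar>Im w\<bar> \<le> norm (w - v)" using abs_Im_le_cmod[of "w - v"] by simp
      then show ?thesis using Im norm_ge_zero[of \<alpha>] by linarith
    qed
    have 2: "1 \<le> norm (companion_factor j m \<sigma> w)"
    proof (cases \<sigma>)
      case Plus
      then have "1 \<le> norm (w - temporal_root \<rho> (\<gamma> j) m Minus)"
        unfolding w_def by (intro far[unfolded w_def]) (simp only: temporal_roots_sum)
      then show ?thesis using Plus by (simp add: norm_power one_le_power del: temporal_root.simps)
    next
      case Minus
      then have "1 \<le> norm (w - temporal_root \<rho> (\<gamma> j) m Plus)"
        using temporal_roots_sum[of \<rho> "\<gamma> j" m] unfolding w_def
        by (intro far[unfolded w_def]) (simp only: add.commute)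
      then show ?thesis using Minus by (simp add: norm_power one_le_power del: temporal_root.simps)
    qed simp
    have "c1 * exp (- C * real m) = 1 * 1 * (c1 * exp (- C * real m))" by simp
    also have "\<dots> \<le> norm (w\<^sup>2 + \<alpha>) * norm (companion_factor j m \<sigma> w) * norm (\<Prod>i. level_factor j m i w)"
    proof (rule mult_mono)
      show "1 * 1 \<le> norm (w\<^sup>2 + \<alpha>) * norm (companion_factor j m \<sigma> w)" using 1 2 by (intro mult_mono) auto
    qed (use level[OF j m'(1,4) root] C in auto)
    finally show ?thesis by (simp add: symbol_def norm_mult w_def)
  qed
  define f where "f = (\<lambda>(j, m, \<sigma>). norm (symbol j m \<sigma> (temporal_root \<rho> (\<gamma> j) m \<sigma>)))"
  define I where "I = {(j, m, \<sigma>) \<in> {1..p0} \<times> {1..<m0} \<times> {Plus, Minus, Crit}. \<sigma> \<in> labels \<rho> (\<gamma> j) m}"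
  have "finite I" unfolding I_def by (rule finite_subset[of _ "{1..p0} \<times> {1..<m0} \<times> {Plus, Minus, Crit}"]) auto
  then have fin: "finite (insert c1 (f ` I))" by blast
  define c where "c = Min (insert c1 (f ` I))"
  show thesis
  proof (rule that[OF C(1), of c])
    show "c > 0" unfolding c_def using fin C symbol_nonzero by (auto simp: f_def I_def)
    fix j m \<sigma> assume j: "j \<in> {1..p0}" and m: "m \<ge> 1" and \<sigma>: "\<sigma> \<in> labels \<rho> (\<gamma> j) m"
    show "norm (symbol j m \<sigma> (temporal_root \<rho> (\<gamma> j) m \<sigma>)) \<ge> c * exp (- C * real m)"
    proof (cases "m \<ge> m0")
      case True
      have "c * exp (- C * real m) \<le> c1 * exp (- C * real m)"
        unfolding c_def using fin by (intro mult_right_mono Min_le) auto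
      then show ?thesis using large[OF j True \<sigma>] by linarith
    next
      case False
      then have "(j, m, \<sigma>) \<in> I" using j m \<sigma> by (cases \<sigma>) (auto simp: I_def)
      then have "c \<le> f (j, m, \<sigma>)" unfolding c_def using fin by (intro Min_le) auto
      moreover have "c * exp (- C * real m) \<le> c * 1" using \<open>c > 0\<close> C by (intro mult_left_mono) auto
      ultimately show ?thesis by (simp add: f_def)
    qed
  qed
qed

end

section \<open>Biorthogonal families\<close>

text \<open>
  The change of variable \<open>\<tau> = T - t\<close>, and the passage from the Lebesgue integral on the open
  interval to the integral over the closed one.
\<close>

lemma lebesgue_on_reflect:
  fixes h :: "real \<Rightarrow> 'b :: euclidean_space"
  assumes h: "continuous_on {0..T} h" and T: "T > 0"
  shows "integrable (lebesgue_on {0<..<T}) (\<lambda>t. h (T - t))"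
    and "(LINT t|lebesgue_on {0<..<T}. h (T - t)) = integral {0..T} h"
proof -
  have "continuous_on {0..T} (\<lambda>t. h (T - t))"
    by (rule continuous_on_compose2[OF h]) (auto intro!: continuous_intros)
  then have "(\<lambda>t. h (T - t)) absolutely_integrable_on {0<..<T}"
    by (rule set_integrable_subset[OF absolutely_integrable_continuous_real]) auto
  then show int: "integrable (lebesgue_on {0<..<T}) (\<lambda>t. h (T - t))"
    by (rule absolutely_integrable_imp_integrable) auto
  have "(h has_integral integral {0..T} h) (cbox 0 T)"
    using integrable_integral[OF integrable_continuous_interval[OF h]] by simp
  from has_integral_affinity[OF this, of "-1" T]
  have "((\<lambda>t. h (T - t)) has_integral integral {0..T} h) ((\<lambda>x. T - x) ` {0..T})"
    by (simp add: algebra_simps)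
  also have "(\<lambda>x. T - x) ` {0..T} = {0..T}" by (auto simp: image_iff intro!: bexI[of _ "T - _"])
  finally have "integral {0..T} (\<lambda>t. h (T - t)) = integral {0..T} h" by (rule integral_unique)
  moreover have "integral {0<..<T} (\<lambda>t. h (T - t)) = integral {0..T} (\<lambda>t. h (T - t))"
    using integral_open_interval[of 0 T "\<lambda>t. h (T - t)"] by simp
  moreover have "(LINT t|lebesgue_on {0<..<T}. h (T - t)) = integral {0<..<T} (\<lambda>t. h (T - t))"
    by (rule lebesgue_integral_eq_integral[OF int]) auto
  ultimately show "(LINT t|lebesgue_on {0<..<T}. h (T - t)) = integral {0..T} h" by simp
qed

lemma LINT_reflect_eq_moment:
  assumes "continuous_on {0..T} f" "T > 0"
  shows "(LINT t|lebesgue_on {0<..<T}. (of_real (T - t) ^ r * exp (z * of_real (T - t))) * f (T - t)) = moment T f z r"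
  unfolding moment_def
  by (rule lebesgue_on_reflect(2)[of T "\<lambda>x. of_real x ^ r * exp (z * of_real x) * f x"])
     (intro continuous_intros assms)+

lemma L2_norm_reflect_le:
  assumes f: "continuous_on {0..T} f" and T: "T > 0" and B: "\<And>x. x \<in> {0..T} \<Longrightarrow> norm (f x) \<le> B"
  shows "in_L2 T (\<lambda>t. f (T - t))" "L2_norm T (\<lambda>t. f (T - t)) \<le> sqrt T * B"
proof -
  have sq: "continuous_on {0..T} (\<lambda>x. (norm (f x))\<^sup>2)" by (intro continuous_intros f)
  show "in_L2 T (\<lambda>t. f (T - t))"
    unfolding in_L2_def
    using borel_measurable_integrable[OF lebesgue_on_reflect(1)[OF f T]] lebesgue_on_reflect(1)[OF sq T] by blast
  have B0: "B \<ge> 0" using order.trans[OF norm_ge_zero B[of 0]] T by simp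
  have "integral {0..T} (\<lambda>x. (norm (f x))\<^sup>2) \<le> integral {0..T} (\<lambda>x. B\<^sup>2)"
    using B by (intro integral_le integrable_continuous_interval sq continuous_intros power_mono) auto
  also have "\<dots> = T * B\<^sup>2" using T by simp
  finally have "L2_norm T (\<lambda>t. f (T - t)) \<le> sqrt (T * B\<^sup>2)"
    unfolding L2_norm_def lebesgue_on_reflect(2)[OF sq T] by simp
  then show "L2_norm T (\<lambda>t. f (T - t)) \<le> sqrt T * B" using B0 T by (simp add: real_sqrt_mult)
qed

lemma chi_eq_exponential_monomial:
  assumes "d \<in> {0, 1}"
  obtains v r where "v = \<omega> \<or> v = - \<omega>" "r < (if \<omega> = 0 then 2 else (1::nat))"
    "\<And>t. chi T \<omega> d t = of_real (T - t) ^ r * exp (v * of_real (T - t))"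
proof (cases "\<omega> = 0")
  case True
  show ?thesis by (rule that[of \<omega> d]) (use assms True in \<open>auto simp: chi_def\<close>)
next
  case False
  show ?thesis by (rule that[of "if d = 0 then \<omega> else - \<omega>" 0]) (use assms False in \<open>auto simp: chi_def\<close>)
qed

theorem lemma2:
  fixes T \<rho> :: real and N p0 :: nat and A :: "complex mat"
    and \<gamma> :: "nat \<Rightarrow> complex" and \<alpha> \<omega> :: complex
  assumes "T > 0" and "0 < \<rho>" and "\<rho> < 2"
    and "A \<in> carrier_mat N N"
    and "bij_betw \<gamma> {1..p0} (spectrum A)"
    and "\<And>j k m n \<sigma> \<eta>. j \<in> {1..p0} \<Longrightarrow> k \<in> {1..p0} \<Longrightarrow> m \<ge> 1 \<Longrightarrow> n \<ge> 1 \<Longrightarrow>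
           \<sigma> \<in> {Plus, Minus} \<Longrightarrow> \<eta> \<in> {Plus, Minus} \<Longrightarrow> (j, m) \<noteq> (k, n) \<Longrightarrow>
           temporal_root \<rho> (\<gamma> j) m \<sigma> \<noteq> temporal_root \<rho> (\<gamma> k) n \<eta>"
    and "\<And>j m \<sigma>. j \<in> {1..p0} \<Longrightarrow> m \<ge> 1 \<Longrightarrow> \<sigma> \<in> labels \<rho> (\<gamma> j) m \<Longrightarrow>
           (temporal_root \<rho> (\<gamma> j) m \<sigma>)\<^sup>2 + \<alpha> \<noteq> 0"
    and "\<omega>\<^sup>2 = - \<alpha>"
  shows "\<exists>(g :: nat \<Rightarrow> nat \<Rightarrow> nat \<Rightarrow> label \<Rightarrow> real \<Rightarrow> complex) (M :: real) (C :: real).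
           M \<ge> 0 \<and> C > 0 \<and>
           (\<forall>(j, q, m, \<sigma>) \<in> admissible A \<rho> p0 \<gamma>.
              in_L2 T (g j q m \<sigma>) \<and>
              (\<forall>(p, r, n, \<eta>) \<in> admissible A \<rho> p0 \<gamma>.
                 (LINT t|lebesgue_on {0<..<T}. exp_mode T \<rho> (\<gamma> p) r n \<eta> t * g j q m \<sigma> t)
                 = (if j = p \<and> q = r \<and> m = n \<and> \<sigma> = \<eta> then 1 else 0)) \<and>
              (\<forall>d \<in> {0, 1}.
                 (LINT t|lebesgue_on {0<..<T}. chi T \<omega> d t * g j q m \<sigma> t) = 0) \<and>
              L2_norm T (g j q m \<sigma>) \<le> C * (1 + real m) powr M * exp (C * real m))"
proof -
  note T = \<open>T > 0\<close>
  define \<nu> where "\<nu> = (\<Sum>k\<in>{1..p0}. largest_jordan_block A (\<gamma> k))"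
  interpret temporal_spectrum \<rho> p0 \<gamma> \<alpha> \<nu>
    using assms by unfold_locales blast+
  have chain: "chain_length A (\<gamma> k) \<eta> \<le> (if \<eta> = Crit then 2 * \<nu> else \<nu>)" if "k \<in> {1..p0}" for k \<eta>
  proof -
    have "largest_jordan_block A (\<gamma> k) \<le> \<nu>" unfolding \<nu>_def by (rule member_le_sum) (use that in auto)
    then show ?thesis by (cases \<eta>) auto
  qed
  obtain K C1 where K: "K > 0" "C1 \<ge> 0"
    and up: "\<And>j m \<sigma> z. j \<in> {1..p0} \<Longrightarrow> m \<ge> 1 \<Longrightarrow> norm (symbol j m \<sigma> z) \<le> K * exp (C1 * (sqrt (norm z) + real m))"
    using that by (rule symbol_norm_le)
  obtain C2 c where c: "C2 \<ge> 0" "c > 0"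
    and low: "\<And>j m \<sigma>. j \<in> {1..p0} \<Longrightarrow> m \<ge> 1 \<Longrightarrow> \<sigma> \<in> labels \<rho> (\<gamma> j) m \<Longrightarrow>
       norm (symbol j m \<sigma> (temporal_root \<rho> (\<gamma> j) m \<sigma>)) \<ge> c * exp (- C2 * real m)"
    using that by (rule symbol_lower_bound)
  define C where "C = max C1 C2"
  define X where "X = 3 + \<Gamma>"
  have C: "C \<ge> 0" "C1 \<le> C" "C2 \<le> C" and X: "X \<ge> 0" using K \<Gamma>_nonneg by (auto simp: C_def X_def)
  obtain D where D: "D > 0" and ex: "\<And>m w R. \<lbrakk>m \<ge> 1; norm w \<le> X * m\<^sup>2; Re w \<le> X; R holomorphic_on UNIV;
        \<forall>z. norm (R z) \<le> K * exp (C * (sqrt (norm z) + m)); norm (R w) \<ge> c * exp (- C * m)\<rbrakk>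
      \<Longrightarrow> \<exists>g. \<forall>q<2 * \<nu>. continuous_on {0..T} (g q) \<and>
            (\<forall>x\<in>{0..T}. norm (g q x) \<le> D * exp (D * m)) \<and>
            (\<forall>r<2 * \<nu>. moment T (g q) w r = (if q = r then 1 else 0)) \<and>
            (\<forall>v r e. vanishes_to_order R v e \<longrightarrow> r < e \<longrightarrow> moment T (g q) v r = 0)"
    using that by (rule exists_biorthogonal_chain[OF T C(1) X K(1) c(2), of "2 * \<nu>"])
  define P where "P j m \<sigma> g \<longleftrightarrow> (\<forall>q<2 * \<nu>. continuous_on {0..T} (g q) \<and>
            (\<forall>x\<in>{0..T}. norm (g q x) \<le> D * exp (D * real m)) \<and>
            (\<forall>r<2 * \<nu>. moment T (g q) (temporal_root \<rho> (\<gamma> j) m \<sigma>) r = (if q = r then 1 else 0)) \<and>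
            (\<forall>v r e. vanishes_to_order (symbol j m \<sigma>) v e \<longrightarrow> r < e \<longrightarrow> moment T (g q) v r = 0))" for j m \<sigma> g
  have exP: "\<exists>g. P j m \<sigma> g" if j: "j \<in> {1..p0}" and m: "m \<ge> 1" and \<sigma>: "\<sigma> \<in> labels \<rho> (\<gamma> j) m" for j m \<sigma>
    unfolding P_def
  proof (rule ex)
    have root: "temporal_poly \<rho> (\<gamma> j) m (temporal_root \<rho> (\<gamma> j) m \<sigma>) = 0" by (rule temporal_poly_root[OF \<sigma>])
    show "real m \<ge> 1" using m by simp
    show "norm (temporal_root \<rho> (\<gamma> j) m \<sigma>) \<le> X * (real m)\<^sup>2"
      unfolding X_def by (rule root_norm_le[OF \<rho> norm_\<gamma>_le[OF j] m root])
    show "Re (temporal_root \<rho> (\<gamma> j) m \<sigma>) \<le> X"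
      using root_Re_le[OF \<rho> norm_\<gamma>_le[OF j] root] unfolding X_def by linarith
    show "symbol j m \<sigma> holomorphic_on UNIV" by (rule symbol_holomorphic)
    show "\<forall>z. norm (symbol j m \<sigma> z) \<le> K * exp (C * (sqrt (norm z) + real m))"
    proof
      fix z :: complex
      have "K * exp (C1 * (sqrt (norm z) + real m)) \<le> K * exp (C * (sqrt (norm z) + real m))"
        using K C by (simp add: mult_right_mono)
      then show "norm (symbol j m \<sigma> z) \<le> K * exp (C * (sqrt (norm z) + real m))"
        using up[OF j m, of \<sigma> z] by linarith
    qed
    have "c * exp (- C * real m) \<le> c * exp (- C2 * real m)" using c C by (simp add: mult_right_mono)
    then show "norm (symbol j m \<sigma> (temporal_root \<rho> (\<gamma> j) m \<sigma>)) \<ge> c * exp (- C * real m)"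
      using low[OF j m \<sigma>] by linarith
  qed
  define G where "G j m \<sigma> = (SOME g. P j m \<sigma> g)" for j m \<sigma>
  have PG: "P j m \<sigma> (G j m \<sigma>)" if "j \<in> {1..p0}" "m \<ge> 1" "\<sigma> \<in> labels \<rho> (\<gamma> j) m" for j m \<sigma>
    unfolding G_def by (rule someI_ex[OF exP[OF that]])
  define g where "g j q m \<sigma> t = G j m \<sigma> q (T - t)" for j q m \<sigma> t
  define D' where "D' = D * (1 + sqrt T)"
  have D': "D' > 0" "D \<le> D'" "sqrt T * D \<le> D'" using D T by (auto simp: D'_def algebra_simps intro: add_pos_nonneg)
  have main: "in_L2 T (g j q m \<sigma>) \<and>
      (\<forall>(p, r, n, \<eta>) \<in> admissible A \<rho> p0 \<gamma>.
         (LINT t|lebesgue_on {0<..<T}. exp_mode T \<rho> (\<gamma> p) r n \<eta> t * g j q m \<sigma> t)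
         = (if j = p \<and> q = r \<and> m = n \<and> \<sigma> = \<eta> then 1 else 0)) \<and>
      (\<forall>d \<in> {0, 1}. (LINT t|lebesgue_on {0<..<T}. chi T \<omega> d t * g j q m \<sigma> t) = 0) \<and>
      L2_norm T (g j q m \<sigma>) \<le> D' * (1 + real m) powr 0 * exp (D' * real m)"
    if adm: "(j, q, m, \<sigma>) \<in> admissible A \<rho> p0 \<gamma>" for j q m \<sigma>
  proof -
    have j: "j \<in> {1..p0}" and m: "m \<ge> 1" and \<sigma>: "\<sigma> \<in> labels \<rho> (\<gamma> j) m" and q: "q < 2 * \<nu>"
      using adm chain[of j \<sigma>] by (auto simp: admissible_def split: if_splits)
    define f where "f = G j m \<sigma> q"
    have f: "continuous_on {0..T} f" "\<And>x. x \<in> {0..T} \<Longrightarrow> norm (f x) \<le> D * exp (D * real m)"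
        "\<And>r. r < 2 * \<nu> \<Longrightarrow> moment T f (temporal_root \<rho> (\<gamma> j) m \<sigma>) r = (if q = r then 1 else 0)"
        "\<And>v r e. vanishes_to_order (symbol j m \<sigma>) v e \<Longrightarrow> r < e \<Longrightarrow> moment T f v r = 0"
      using PG[OF j m \<sigma>] q unfolding P_def f_def by blast+
    have g_eq: "g j q m \<sigma> = (\<lambda>t. f (T - t))" by (simp add: g_def f_def fun_eq_iff)
    have "in_L2 T (g j q m \<sigma>)" unfolding g_eq by (rule L2_norm_reflect_le(1)[OF f(1) T f(2)])
    moreover have "(LINT t|lebesgue_on {0<..<T}. exp_mode T \<rho> (\<gamma> p) r n \<eta> t * g j q m \<sigma> t)
         = (if j = p \<and> q = r \<and> m = n \<and> \<sigma> = \<eta> then 1 else 0)"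
      if adm': "(p, r, n, \<eta>) \<in> admissible A \<rho> p0 \<gamma>" for p r n \<eta>
    proof -
      have p: "p \<in> {1..p0}" and n: "n \<ge> 1" and \<eta>: "\<eta> \<in> labels \<rho> (\<gamma> p) n"
        and r: "r < (if \<eta> = Crit then 2 * \<nu> else \<nu>)"
        using adm' chain[of p \<eta>] by (auto simp: admissible_def split: if_splits)
      have "(LINT t|lebesgue_on {0<..<T}. exp_mode T \<rho> (\<gamma> p) r n \<eta> t * g j q m \<sigma> t)
          = moment T f (temporal_root \<rho> (\<gamma> p) n \<eta>) r"
        unfolding g_eq exp_mode_def by (rule LINT_reflect_eq_moment[OF f(1) T])
      also have "\<dots> = (if j = p \<and> q = r \<and> m = n \<and> \<sigma> = \<eta> then 1 else 0)"
      proof (cases "(p, n) = (j, m)")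
        case False
        then show ?thesis using f(4)[OF symbol_vanishes_at_other_level[OF p n False \<eta>] r] by auto
      next
        case same: True
        show ?thesis
        proof (cases "\<eta> = \<sigma>")
          case True
          then show ?thesis using same r f(3)[of r] by (auto split: if_splits)
        next
          case False
          have \<eta>': "\<eta> \<in> labels \<rho> (\<gamma> j) m" using \<eta> same by simp
          note comp = symbol_vanishes_at_companion[OF \<sigma> \<eta>' False]
          have "moment T f (temporal_root \<rho> (\<gamma> j) m \<eta>) r = 0"
            using f(4)[OF comp(2)] r comp(1) by simp
          then show ?thesis using same False by auto
        qed
      qed
      finally show ?thesis .
    qed
    moreover have "(LINT t|lebesgue_on {0<..<T}. chi T \<omega> d t * g j q m \<sigma> t) = 0" if d: "d \<in> {0, 1}" for d
    proof -
      obtain v r where v: "v = \<omega> \<or> v = - \<omega>" and r: "r < (if \<omega> = 0 then 2 else (1::nat))"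
        and chi: "\<And>t. chi T \<omega> d t = of_real (T - t) ^ r * exp (v * of_real (T - t))"
        using chi_eq_exponential_monomial[OF d] by metis
      have "(LINT t|lebesgue_on {0<..<T}. chi T \<omega> d t * g j q m \<sigma> t) = moment T f v r"
        unfolding g_eq chi by (rule LINT_reflect_eq_moment[OF f(1) T])
      also have "\<dots> = 0"
      proof (rule f(4)[OF symbol_vanishes_at_chi])
        show "v\<^sup>2 = - \<alpha>" using v assms(8) by auto
        show "r < (if v = 0 then 2 else 1)" using v r by auto
      qed
      finally show ?thesis .
    qed
    moreover have "L2_norm T (g j q m \<sigma>) \<le> D' * (1 + real m) powr 0 * exp (D' * real m)"
    proof -
      have "L2_norm T (g j q m \<sigma>) \<le> sqrt T * (D * exp (D * real m))"
        unfolding g_eq by (rule L2_norm_reflect_le(2)[OF f(1) T f(2)])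
      also have "\<dots> = (sqrt T * D) * exp (D * real m)" by simp
      also have "\<dots> \<le> D' * exp (D' * real m)" using D D' by (intro mult_mono) (auto intro: mult_right_mono)
      finally show ?thesis by simp
    qed
    ultimately show ?thesis by blast
  qed
  show ?thesis
  proof (rule exI[of _ g], rule exI[of _ "0 :: real"], rule exI[of _ D'], intro conjI)
    show "\<forall>(j, q, m, \<sigma>) \<in> admissible A \<rho> p0 \<gamma>.
              in_L2 T (g j q m \<sigma>) \<and>
              (\<forall>(p, r, n, \<eta>) \<in> admissible A \<rho> p0 \<gamma>.
                 (LINT t|lebesgue_on {0<..<T}. exp_mode T \<rho> (\<gamma> p) r n \<eta> t * g j q m \<sigma> t)
                 = (if j = p \<and> q = r \<and> m = n \<and> \<sigma> = \<eta> then 1 else 0)) \<and>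
              (\<forall>d \<in> {0, 1}.
                 (LINT t|lebesgue_on {0<..<T}. chi T \<omega> d t * g j q m \<sigma> t) = 0) \<and>
              L2_norm T (g j q m \<sigma>) \<le> D' * (1 + real m) powr 0 * exp (D' * real m)"
      using main by blast
  qed (use D' in auto)
qed

end
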